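(* Let $(X,d)$ be a geodesic metric space with basepoint $o$, and let $G$ be a countable group of isometries of $X$ containing two independent contracting isometries. Let $\mu$ be a non-elementary probability measure on $G$ with finite first moment. Then there exist $C,\epsilon>0$ such that \[ |l(\mu')-l(\mu)| \le C\,\|\mu'-\mu\|_{0,1} \] for every probability measure $\mu'$ on $G$ with $\|\mu'-\mu\|_{0,1}<\epsilon$.
   Context: For a closed set $A\subseteq X$, $\pi_A$ denotes closest point projection onto $A$. A $K$-quasigeodesic $\gamma$ is a $K$-contracting axis if $\operatorname{diam}(\pi_\gamma(\eta))<K$ for every geodesic $\eta$ not entering the $K$-neighborhood of $\gamma$. An isometry $g$ is contracting if its orbit $\{g^i o\}_{i\in\mathbb Z}$ is a $K$-contracting axis for some $K$; two contracting isometries are independent if their orbits have bounded projections onto each other. A probability measure $\mu$ on $G$ is non-elementary if the semigroup generated by its support contains two independent contracting isometries. For $g\in G$ write $\|g\|=d(o,go)$. For a signed measure $\eta$ on $G$: $\|\eta\|_0=\sum_g|\eta(g)|$, $\|\eta\|_1=\sum_g d(o,go)|\eta(g)|$, $\|\eta\|_{0,1}=\|\eta\|_0+\|\eta\|_1$. $\mu$ has finite first moment if $\|\mu\|_1<\infty$. With $L(\mu)=\sum_g\mu(g)d(o,go)$, the escape rate is $l(\mu)=\lim_{n\to\infty}L(\mu^{*n})/n$, where $\mu^{*n}$ is the $n$-fold convolution. *)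

theory Defs
  imports "HOL-Probability.Probability"
begin

definition geodesic_space :: "'a::metric_space itself \<Rightarrow> bool" where
  "geodesic_space _ \<longleftrightarrow>
     (\<forall>x y::'a. \<exists>\<gamma>::real \<Rightarrow> 'a. \<gamma> 0 = x \<and> \<gamma> (dist x y) = y \<and>
        (\<forall>s\<in>{0..dist x y}. \<forall>t\<in>{0..dist x y}. dist (\<gamma> s) (\<gamma> t) = \<bar>s - t\<bar>))"

definition geodesic_segment :: "'a::metric_space set \<Rightarrow> bool" where
  "geodesic_segment S \<longleftrightarrow>
     (\<exists>a b (\<gamma>::real \<Rightarrow> 'a). a \<le> b \<and>
        (\<forall>s\<in>{a..b}. \<forall>t\<in>{a..b}. dist (\<gamma> s) (\<gamma> t) = \<bar>s - t\<bar>) \<and> S = \<gamma> ` {a..b})"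

definition proj :: "'a::metric_space set \<Rightarrow> 'a \<Rightarrow> 'a set" where
  "proj A x = {a \<in> A. dist x a = infdist x A}"

definition proj_set :: "'a::metric_space set \<Rightarrow> 'a set \<Rightarrow> 'a set" where
  "proj_set A S = (\<Union>x\<in>S. proj A x)"

definition quasigeodesic :: "real \<Rightarrow> (int \<Rightarrow> 'a::metric_space) \<Rightarrow> bool" where
  "quasigeodesic K f \<longleftrightarrow>
     (\<forall>i j. \<bar>real_of_int (i - j)\<bar> / K - K \<le> dist (f i) (f j) \<and>
            dist (f i) (f j) \<le> K * \<bar>real_of_int (i - j)\<bar> + K)"

definition contracting_axis :: "real \<Rightarrow> (int \<Rightarrow> 'a::metric_space) \<Rightarrow> bool" where
  "contracting_axis K f \<longleftrightarrow> quasigeodesic K f \<and>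
     (\<forall>\<eta>. geodesic_segment \<eta> \<longrightarrow> (\<forall>y\<in>\<eta>. K \<le> infdist y (range f)) \<longrightarrow>
        bounded (proj_set (range f) \<eta>) \<and> diameter (proj_set (range f) \<eta>) < K)"

definition isometry :: "('a::metric_space \<Rightarrow> 'a) \<Rightarrow> bool" where
  "isometry g \<longleftrightarrow> bij g \<and> (\<forall>x y. dist (g x) (g y) = dist x y)"

definition isometry_group :: "('a::metric_space \<Rightarrow> 'a) set \<Rightarrow> bool" where
  "isometry_group G \<longleftrightarrow> (\<forall>g\<in>G. isometry g) \<and> id \<in> G \<and>
     (\<forall>g\<in>G. \<forall>h\<in>G. g \<circ> h \<in> G) \<and> (\<forall>g\<in>G. inv g \<in> G)"

definition zpow :: "('a \<Rightarrow> 'a) \<Rightarrow> int \<Rightarrow> ('a \<Rightarrow> 'a)" where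
  "zpow g i = (if 0 \<le> i then g ^^ nat i else inv g ^^ nat (- i))"

definition orbit_map :: "'a \<Rightarrow> ('a \<Rightarrow> 'a) \<Rightarrow> int \<Rightarrow> 'a" where
  "orbit_map bp g = (\<lambda>i. zpow g i bp)"

definition contracting :: "'a::metric_space \<Rightarrow> ('a \<Rightarrow> 'a) \<Rightarrow> bool" where
  "contracting bp g \<longleftrightarrow> (\<exists>K>0. contracting_axis K (orbit_map bp g))"

definition independent :: "'a::metric_space \<Rightarrow> ('a \<Rightarrow> 'a) \<Rightarrow> ('a \<Rightarrow> 'a) \<Rightarrow> bool" where
  "independent bp g h \<longleftrightarrow> contracting bp g \<and> contracting bp h \<and>
     bounded (proj_set (range (orbit_map bp g)) (range (orbit_map bp h))) \<and>
     bounded (proj_set (range (orbit_map bp h)) (range (orbit_map bp g)))"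

inductive_set semigroup_gen :: "('a \<Rightarrow> 'a) set \<Rightarrow> ('a \<Rightarrow> 'a) set" for S where
  base: "g \<in> S \<Longrightarrow> g \<in> semigroup_gen S"
| comp: "g \<in> semigroup_gen S \<Longrightarrow> h \<in> semigroup_gen S \<Longrightarrow> g \<circ> h \<in> semigroup_gen S"

definition non_elementary :: "'a::metric_space \<Rightarrow> ('a \<Rightarrow> 'a) pmf \<Rightarrow> bool" where
  "non_elementary bp \<mu> \<longleftrightarrow>
     (\<exists>g\<in>semigroup_gen (set_pmf \<mu>). \<exists>h\<in>semigroup_gen (set_pmf \<mu>). independent bp g h)"

definition word_norm :: "'a::metric_space \<Rightarrow> ('a \<Rightarrow> 'a) \<Rightarrow> real" where
  "word_norm bp g = dist bp (g bp)"

definition finite_first_moment :: "'a::metric_space \<Rightarrow> ('a \<Rightarrow> 'a) pmf \<Rightarrow> bool" where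
  "finite_first_moment bp \<mu> \<longleftrightarrow> (\<lambda>g. word_norm bp g * pmf \<mu> g) summable_on UNIV"

primrec conv_pow :: "('a \<Rightarrow> 'a) pmf \<Rightarrow> nat \<Rightarrow> ('a \<Rightarrow> 'a) pmf" where
  "conv_pow \<mu> 0 = return_pmf id"
| "conv_pow \<mu> (Suc n) = bind_pmf (conv_pow \<mu> n) (\<lambda>g. map_pmf (\<lambda>h. g \<circ> h) \<mu>)"

definition L_mean :: "'a::metric_space \<Rightarrow> ('a \<Rightarrow> 'a) pmf \<Rightarrow> real" where
  "L_mean bp \<mu> = (\<Sum>\<^sub>\<infinity>g. pmf \<mu> g * word_norm bp g)"

definition escape_rate :: "'a::metric_space \<Rightarrow> ('a \<Rightarrow> 'a) pmf \<Rightarrow> real" where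
  "escape_rate bp \<mu> = lim (\<lambda>n. L_mean bp (conv_pow \<mu> n) / real n)"

text \<open>Norms of signed measures on G (given as real functions).\<close>
definition norm0 :: "(('a \<Rightarrow> 'a) \<Rightarrow> real) \<Rightarrow> real" where
  "norm0 \<eta> = (\<Sum>\<^sub>\<infinity>g. \<bar>\<eta> g\<bar>)"

definition norm1 :: "'a::metric_space \<Rightarrow> (('a \<Rightarrow> 'a) \<Rightarrow> real) \<Rightarrow> real" where
  "norm1 bp \<eta> = (\<Sum>\<^sub>\<infinity>g. word_norm bp g * \<bar>\<eta> g\<bar>)"

definition norm01 :: "'a::metric_space \<Rightarrow> (('a \<Rightarrow> 'a) \<Rightarrow> real) \<Rightarrow> real" where
  "norm01 bp \<eta> = norm0 \<eta> + norm1 bp \<eta>"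

definition finite_norm01 :: "'a::metric_space \<Rightarrow> (('a \<Rightarrow> 'a) \<Rightarrow> real) \<Rightarrow> bool" where
  "finite_norm01 bp \<eta> \<longleftrightarrow> (\<lambda>g. \<bar>\<eta> g\<bar>) summable_on UNIV \<and>
      (\<lambda>g. word_norm bp g * \<bar>\<eta> g\<bar>) summable_on UNIV"

end

theory Submission
  imports Defs
begin

text \<open>
  Write \<open>(x|y)\<close> for the Gromov product at the base point \<open>o\<close>. The point is that \<open>(x|v o)\<close> has bounded
  mean for \<open>v\<close> distributed as \<open>\<mu>\<^sup>*\<^sup>n\<close>, uniformly in \<open>x\<close> and \<open>n\<close>. Granting this, write
  \<open>\<mu>'\<^sup>*\<^sup>n - \<mu>\<^sup>*\<^sup>n\<close> as the telescoping sum of the convolutions of \<open>\<mu>'\<^sup>*\<^sup>k\<close>, \<open>\<mu>' - \<mu>\<close> and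
  \<open>\<mu>\<^sup>*\<^sup>n\<^sup>-\<^sup>k\<^sup>-\<^sup>1\<close>. Since \<open>\<mu>' - \<mu>\<close> has total mass zero, each term changes \<open>L\<close> by at most a constant
  times \<open>\<parallel>\<mu>' - \<mu>\<parallel>\<^sub>0\<^sub>,\<^sub>1\<close>, so only \<open>\<mu>\<close> has to be non-elementary.

  For the uniform bound cut the walk into blocks. A block spelling a word in large powers of the two
  contracting isometries is left-good for almost all words given the past \<open>x\<close>, and right-good for
  almost all words given the future \<open>y\<close>; a block \<open>s\<close> that is both keeps \<open>(x|s y)\<close> bounded in terms of
  the length of \<open>s\<close>. Hence the Gromov product is at most the total length of the blocks up to the
  first good one, up to constants. Badness on the left is controlled by revealing the blocks forwards,
  badness on the right by revealing them backwards, and the two are decoupled by the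
  arithmetic-geometric mean inequality. Conditioning on a single long increment does not affect these
  estimates, which is why a first moment suffices.
\<close>

section \<open>Projections to contracting axes\<close>

lemma mem_proj_iff:
  assumes "A \<noteq> {}"
  shows "a \<in> proj A x \<longleftrightarrow> a \<in> A \<and> (\<forall>b\<in>A. dist x a \<le> dist x b)"
proof
  assume "a \<in> proj A x"
  then show "a \<in> A \<and> (\<forall>b\<in>A. dist x a \<le> dist x b)"
    by (auto simp: proj_def intro: infdist_le)
next
  assume a: "a \<in> A \<and> (\<forall>b\<in>A. dist x a \<le> dist x b)"
  then have "dist x a \<le> infdist x A"
    using assms by (simp add: infdist_notempty cINF_greatest)
  with a show "a \<in> proj A x"
    by (auto simp: proj_def intro!: antisym infdist_le)
qed

lemma quasigeodesic_index_diff_le: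
  assumes "quasigeodesic K f" "0 < K" "dist (f i) (f j) \<le> T"
  shows "\<bar>real_of_int (i - j)\<bar> \<le> K * (T + K)"
proof -
  have "\<bar>real_of_int (i - j)\<bar> / K - K \<le> dist (f i) (f j)"
    using assms(1) unfolding quasigeodesic_def by blast
  with assms(3) have "\<bar>real_of_int (i - j)\<bar> / K \<le> T + K" by linarith
  with assms(2) show ?thesis by (simp add: field_simps)
qed

lemma quasigeodesic_proj_nonempty:
  assumes "quasigeodesic K f" "0 < K"
  shows "proj (range f) x \<noteq> {}"
proof -
  define J where "J = {i. dist x (f i) \<le> dist x (f 0)}"
  define B where "B = \<lceil>K * (2 * dist x (f 0) + K)\<rceil>"
  have "J \<subseteq> {-B..B}"
  proof
    fix i assume "i \<in> J"
    then have "dist (f i) (f 0) \<le> 2 * dist x (f 0)"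
      using dist_triangle3[of "f i" "f 0" x] by (simp add: J_def)
    from quasigeodesic_index_diff_le[OF assms this] show "i \<in> {-B..B}"
      unfolding B_def atLeastAtMost_iff by linarith
  qed
  then have "finite J" by (rule finite_subset) simp
  moreover have "0 \<in> J" by (simp add: J_def)
  ultimately obtain i where i: "i \<in> J" "\<And>j. j \<in> J \<Longrightarrow> dist x (f i) \<le> dist x (f j)"
    using ex_min_if_finite[of "(\<lambda>i. dist x (f i)) ` J"] by (force simp: not_less)
  have "dist x (f i) \<le> dist x (f j)" for j
    using i(1) i(2)[of j] by (cases "j \<in> J") (auto simp: J_def)
  then have "f i \<in> proj (range f) x" by (simp add: mem_proj_iff)
  then show ?thesis by blast
qed

definition geodesic_path :: "real \<Rightarrow> (real \<Rightarrow> 'a::metric_space) \<Rightarrow> bool" where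
  "geodesic_path T \<gamma> \<longleftrightarrow>
     0 \<le> T \<and> (\<forall>s\<in>{0..T}. \<forall>t\<in>{0..T}. dist (\<gamma> s) (\<gamma> t) = \<bar>s - t\<bar>)"

lemma geodesic_path_dist:
  "geodesic_path T \<gamma> \<Longrightarrow> s \<in> {0..T} \<Longrightarrow> t \<in> {0..T} \<Longrightarrow> dist (\<gamma> s) (\<gamma> t) = \<bar>s - t\<bar>"
  by (simp add: geodesic_path_def)

lemma geodesic_path_initial:
  "geodesic_path T \<gamma> \<Longrightarrow> t \<in> {0..T} \<Longrightarrow> geodesic_path t \<gamma>"
  by (simp add: geodesic_path_def)

lemma geodesic_path_reverse: "geodesic_path T \<gamma> \<Longrightarrow> geodesic_path T (\<lambda>t. \<gamma> (T - t))"
  by (auto simp: geodesic_path_def)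

lemma geodesic_segment_path: "geodesic_path T \<gamma> \<Longrightarrow> geodesic_segment (\<gamma> ` {0..T})"
  unfolding geodesic_segment_def geodesic_path_def
  by (intro exI[of _ 0] exI[of _ T] exI[of _ \<gamma>]) simp

lemma continuous_on_geodesic_path:
  assumes "geodesic_path T \<gamma>" shows "continuous_on {0..T} \<gamma>"
  unfolding continuous_on_iff using geodesic_path_dist[OF assms]
  by (metis dist_real_def)

lemma geodesic_space_path:
  fixes x y :: "'a::metric_space"
  assumes "geodesic_space TYPE('a)"
  obtains \<gamma> where "geodesic_path (dist x y) \<gamma>" "\<gamma> 0 = x" "\<gamma> (dist x y) = y"
  using assms unfolding geodesic_space_def geodesic_path_def by (metis zero_le_dist)

lemma first_hitting_time:
  fixes d :: "real \<Rightarrow> real"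
  assumes "continuous_on {a..b} d" "t \<in> {a..b}" "d t \<le> K"
  obtains s where "s \<in> {a..t}" "d s \<le> K" "s = a \<or> (\<forall>r\<in>{a..s}. K \<le> d r)"
proof -
  define Z where "Z = {a..b} \<inter> d -` {..K}"
  have "closed Z" unfolding Z_def by (intro continuous_closed_preimage assms(1)) simp_all
  moreover have "bounded Z" unfolding Z_def by (rule bounded_subset[of "{a..b}"]) auto
  ultimately have "compact Z" by (simp add: compact_eq_bounded_closed)
  moreover have "t \<in> Z" using assms by (simp add: Z_def)
  ultimately obtain s where s: "s \<in> Z" "\<And>r. r \<in> Z \<Longrightarrow> s \<le> r"
    using compact_attains_inf[of Z] by blast
  have "s \<in> {a..b}" "d s \<le> K" "s \<le> t" using s \<open>t \<in> Z\<close> by (auto simp: Z_def)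
  have before: "K < d r" if "r \<in> {a..<s}" for r
    using that s(2)[of r] \<open>s \<in> {a..b}\<close> by (force simp: Z_def)
  have "K \<le> d s" if "s \<noteq> a"
  proof -
    have "a \<le> s" "K \<le> d a" using before[of a] that \<open>s \<in> {a..b}\<close> by auto
    moreover have "continuous_on {a..s} d"
      using assms(1) \<open>s \<in> {a..b}\<close> by (auto intro: continuous_on_subset)
    ultimately obtain r where "r \<in> {a..s}" "d r = K"
      using IVT2'[of d s K a] \<open>d s \<le> K\<close> by auto
    then show ?thesis using before[of r] by force
  qed
  then have "s = a \<or> (\<forall>r\<in>{a..s}. K \<le> d r)"
    using before by (force simp: le_less)
  with that \<open>s \<in> {a..b}\<close> \<open>d s \<le> K\<close> \<open>s \<le> t\<close> show ?thesis by auto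
qed

lemma contracting_axis_proj_far_path:
  assumes axis: "contracting_axis K f" and path: "geodesic_path T \<gamma>"
    and far: "\<forall>t\<in>{0..T}. K \<le> infdist (\<gamma> t) (range f)"
    and p: "p \<in> proj (range f) (\<gamma> 0)" and q: "q \<in> proj (range f) (\<gamma> T)"
  shows "dist p q \<le> K"
proof -
  let ?P = "proj_set (range f) (\<gamma> ` {0..T})"
  have "bounded ?P" "diameter ?P < K"
    using axis far geodesic_segment_path[OF path] unfolding contracting_axis_def by blast+
  moreover have "p \<in> ?P" "q \<in> ?P"
    using p q path by (auto simp: proj_set_def geodesic_path_def)
  ultimately show ?thesis using diameter_bounded_bound by fastforce
qed

lemma contracting_axis_first_entrance:
  assumes axis: "contracting_axis K f" and K_pos: "0 < K" and path: "geodesic_path T \<gamma>"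
    and p: "p \<in> proj (range f) (\<gamma> 0)"
    and t: "t \<in> {0..T}" "infdist (\<gamma> t) (range f) \<le> K"
  obtains s where "s \<in> {0..t}" "dist p (\<gamma> s) \<le> 2 * K"
proof -
  have "continuous_on {0..T} (\<lambda>t. infdist (\<gamma> t) (range f))"
    by (intro continuous_on_infdist continuous_on_geodesic_path path)
  from first_hitting_time[OF this t] obtain s where s: "s \<in> {0..t}" "infdist (\<gamma> s) (range f) \<le> K"
    and far: "s = 0 \<or> (\<forall>r\<in>{0..s}. K \<le> infdist (\<gamma> r) (range f))" .
  have "geodesic_path s \<gamma>" using path s t by (auto intro: geodesic_path_initial)
  obtain q where q: "q \<in> proj (range f) (\<gamma> s)"
    using quasigeodesic_proj_nonempty axis K_pos unfolding contracting_axis_def by blast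
  have near: "dist q' (\<gamma> s) \<le> K" if "q' \<in> proj (range f) (\<gamma> s)" for q'
    using that s by (simp add: proj_def dist_commute)
  have "dist p (\<gamma> s) \<le> 2 * K"
    using far
  proof
    assume "s = 0"
    then show ?thesis using near[of p] p K_pos by simp
  next
    assume "\<forall>r\<in>{0..s}. K \<le> infdist (\<gamma> r) (range f)"
    then have "dist p q \<le> K"
      using axis \<open>geodesic_path s \<gamma>\<close> p q by (intro contracting_axis_proj_far_path)
    then show ?thesis using near[OF q] dist_triangle[of p "\<gamma> s" q] by linarith
  qed
  with that s show ?thesis by blast
qed

text \<open>
  This is what remains of contraction once geodesics are eliminated: a geodesic between points with
  distant projections passes close to both projections.
\<close>

definition constricting :: "real \<Rightarrow> 'a::metric_space set \<Rightarrow> bool" where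
  "constricting C A \<longleftrightarrow> (\<forall>x. proj A x \<noteq> {}) \<and>
     (\<forall>x y. \<forall>p\<in>proj A x. \<forall>q\<in>proj A y.
        C < dist p q \<longrightarrow> dist x p + dist p q + dist q y \<le> dist x y + C)"

lemma constricting_proj_nonempty: "constricting C A \<Longrightarrow> proj A x \<noteq> {}"
  by (simp add: constricting_def)

lemma constricting_dist:
  "constricting C A \<Longrightarrow> p \<in> proj A x \<Longrightarrow> q \<in> proj A y \<Longrightarrow> C < dist p q \<Longrightarrow>
    dist x p + dist p q + dist q y \<le> dist x y + C"
  by (simp add: constricting_def)

lemma contracting_axis_constricting:
  fixes f :: "int \<Rightarrow> 'a::metric_space"
  assumes geodesic: "geodesic_space TYPE('a)" and axis: "contracting_axis K f" and K_pos: "0 < K"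
  shows "constricting (8 * K) (range f)"
  unfolding constricting_def
proof (intro conjI allI ballI impI)
  show "proj (range f) x \<noteq> {}" for x
    using axis K_pos quasigeodesic_proj_nonempty unfolding contracting_axis_def by blast
  fix x y p q
  assume p: "p \<in> proj (range f) x" and q: "q \<in> proj (range f) y" and far: "8 * K < dist p q"
  define T where "T = dist x y"
  obtain \<gamma> where \<gamma>: "geodesic_path T \<gamma>" "\<gamma> 0 = x" "\<gamma> T = y"
    unfolding T_def by (rule geodesic_space_path[OF geodesic])
  have "\<exists>t\<in>{0..T}. infdist (\<gamma> t) (range f) < K"
    using contracting_axis_proj_far_path[OF axis \<gamma>(1)] p q \<gamma> far K_pos by force
  then obtain t where t: "t \<in> {0..T}" "infdist (\<gamma> t) (range f) \<le> K" by force
  obtain r where r: "r \<in> {0..t}" "dist p (\<gamma> r) \<le> 2 * K"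
    by (rule contracting_axis_first_entrance[OF axis K_pos \<gamma>(1) _ t]) (use p \<gamma> in auto)
  obtain s where s: "s \<in> {0..T - t}" "dist q (\<gamma> (T - s)) \<le> 2 * K"
    by (rule contracting_axis_first_entrance[OF axis K_pos geodesic_path_reverse[OF \<gamma>(1)], of q "T - t"])
      (use q \<gamma> t in auto)
  have "dist x (\<gamma> r) = r" "dist (\<gamma> (T - s)) y = s" "dist (\<gamma> r) (\<gamma> (T - s)) = T - s - r"
    using geodesic_path_dist[OF \<gamma>(1)] \<gamma> r s t by force+
  then have "dist x p \<le> r + 2 * K" "dist q y \<le> s + 2 * K" "dist p q \<le> T - s - r + 4 * K"
    using r s dist_triangle2[of x p "\<gamma> r"] dist_triangle[of q y "\<gamma> (T - s)"]
      dist_triangle[of p q "\<gamma> r"] dist_triangle2[of "\<gamma> r" q "\<gamma> (T - s)"] by linarith+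
  then show "dist x p + dist p q + dist q y \<le> dist x y + 8 * K" by (simp add: T_def)
qed

lemma behrstock_inequality:
  assumes constricting_A: "constricting C A" and constricting_B: "constricting C B" and C_nonneg: "0 \<le> C"
    and proj_onto_A: "proj_set A B \<subseteq> cball z R" and proj_onto_B: "proj_set B A \<subseteq> cball z R"
    and p: "p \<in> proj A x" and q: "q \<in> proj B x"
  shows "dist z p \<le> R + 2 * C \<or> dist z q \<le> R + 2 * C"
proof (rule ccontr)
  assume far: "\<not> ?thesis"
  obtain p' q' where p': "p' \<in> proj A q" and q': "q' \<in> proj B p"
    using constricting_A constricting_B constricting_proj_nonempty by blast
  have "dist z p' \<le> R" "dist z q' \<le> R"
    using proj_onto_A proj_onto_B p q p' q' unfolding proj_set_def proj_def by (auto simp: subset_iff)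
  then have "2 * C < dist p p'" "2 * C < dist q q'"
    using far dist_triangle2[of z p p'] dist_triangle2[of z q q'] by linarith+
  moreover have "dist x p + dist p p' + dist p' q \<le> dist x q + C"
    using \<open>2 * C < dist p p'\<close> C_nonneg by (intro constricting_dist[OF constricting_A p p']) linarith
  moreover have "dist x q + dist q q' + dist q' p \<le> dist x p + C"
    using \<open>2 * C < dist q q'\<close> C_nonneg by (intro constricting_dist[OF constricting_B q q']) linarith
  ultimately show False using C_nonneg zero_le_dist[of p' q] zero_le_dist[of q' p] by linarith
qed

section \<open>Isometries and their powers\<close>

lemma isometry_dist: "isometry g \<Longrightarrow> dist (g x) (g y) = dist x y"
  by (simp add: isometry_def)

lemma isometry_bij: "isometry g \<Longrightarrow> bij g"
  by (simp add: isometry_def)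

lemma isometry_dist_inv:
  assumes "isometry g" shows "dist (inv g x) y = dist x (g y)"
  using assms unfolding isometry_def by (metis bij_inv_eq_iff)

lemma isometry_id: "isometry id"
  by (simp add: isometry_def)

lemma isometry_comp: "isometry g \<Longrightarrow> isometry h \<Longrightarrow> isometry (g \<circ> h)"
  by (auto simp: isometry_def bij_comp)

lemma isometry_inv:
  assumes "isometry g" shows "isometry (inv g)"
  using assms unfolding isometry_def by (metis bij_imp_bij_inv bij_inv_eq_iff)

lemma isometry_funpow: "isometry g \<Longrightarrow> isometry (g ^^ n)"
  by (induction n) (simp_all add: isometry_id isometry_comp)

lemma isometry_foldr: "\<forall>c\<in>set cs. isometry (h c) \<Longrightarrow> isometry (foldr h cs)"
  by (induction cs) (simp_all add: isometry_id isometry_comp)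

lemma isometry_zpow: "isometry g \<Longrightarrow> isometry (zpow g i)"
  by (simp add: zpow_def isometry_funpow isometry_inv)

lemma zpow_of_nat: "zpow g (int n) = g ^^ n"
  by (simp add: zpow_def)

lemma zpow_minus_of_nat: "zpow g (- int n) = inv g ^^ n"
  by (cases "n = 0") (simp_all add: zpow_def)

lemma zpow_succ:
  assumes "bij g" shows "zpow g (i + 1) = g \<circ> zpow g i"
proof (cases i rule: int_cases)
  case (nonneg n)
  then show ?thesis using zpow_of_nat[of g "Suc n"] by (simp add: zpow_of_nat add.commute)
next
  case (neg n)
  then have "zpow g (i + 1) = inv g ^^ n" by (simp add: zpow_minus_of_nat)
  moreover have "g \<circ> inv g = id" using assms by (metis bij_is_surj surj_iff)
  ultimately show ?thesis
    unfolding neg zpow_minus_of_nat by (simp add: fun_eq_iff)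
qed

lemma zpow_add:
  assumes "bij g" shows "zpow g (i + j) = zpow g i \<circ> zpow g j"
proof (induction i rule: int_induct[where k = 0])
  case base
  then show ?case by (simp add: zpow_def)
next
  case (step1 i)
  have "zpow g (i + 1 + j) = zpow g ((i + j) + 1)" by (simp add: ac_simps)
  then show ?case using step1 zpow_succ[OF assms] by (simp add: comp_assoc)
next
  case (step2 i)
  have "g \<circ> zpow g (i - 1 + j) = zpow g (i + j)"
    using zpow_succ[OF assms, of "i - 1 + j"] by simp
  also have "\<dots> = g \<circ> (zpow g (i - 1) \<circ> zpow g j)"
    using step2.IH zpow_succ[OF assms, of "i - 1"] by (simp add: fun_eq_iff)
  finally show ?case using assms by (simp add: bij_is_inj inj_eq fun_eq_iff)
qed

lemma orbit_map_0: "orbit_map bp g 0 = bp"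
  by (simp add: orbit_map_def zpow_def)

lemma zpow_orbit_map:
  assumes "bij g" shows "zpow g n (orbit_map bp g i) = orbit_map bp g (i + n)"
  using zpow_add[OF assms, of n i] by (simp add: orbit_map_def add.commute)

lemma mem_proj_orbit_zpow:
  assumes g: "isometry g"
  shows "orbit_map bp g (i + n) \<in> proj (range (orbit_map bp g)) (zpow g n x) \<longleftrightarrow>
         orbit_map bp g i \<in> proj (range (orbit_map bp g)) x"
proof -
  have "dist (zpow g n x) (orbit_map bp g (j + n)) = dist x (orbit_map bp g j)" for j
    using isometry_dist[OF isometry_zpow[OF g]] by (simp flip: zpow_orbit_map[OF isometry_bij[OF g]])
  then show ?thesis by (simp add: mem_proj_iff) (metis diff_add_cancel)
qed

section \<open>Schottky families\<close>

lemma ex_exceptional_word: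
  fixes T :: "'c \<Rightarrow> 'a \<Rightarrow> 'a" and W :: "nat \<Rightarrow> 'c \<Rightarrow> 'a \<Rightarrow> bool"
  assumes start: "\<And>x. \<exists>c0. \<forall>c. c \<noteq> c0 \<longrightarrow> W 0 c x"
    and step: "\<And>k c c' x. W k c x \<Longrightarrow> W (Suc k) c' (T c x)"
    and mono: "\<And>k c x. W k c x \<Longrightarrow> W (Suc k) c x"
  shows "\<exists>w. \<forall>cs c. length cs = n \<longrightarrow> cs \<noteq> w \<longrightarrow> W n c (fold T cs x)"
proof (induction n arbitrary: x)
  case 0
  then show ?case by (intro exI[of _ "[]"]) simp
next
  case (Suc n)
  have persist: "\<forall>c. W k c y \<Longrightarrow> W (k + length cs) c (fold T cs y)" for k c y cs
  proof (induction cs arbitrary: k y)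
    case (Cons b cs)
    then have "\<forall>c. W (Suc k) c (T b y)" using step by blast
    from Cons.IH[OF this] show ?case by simp
  qed simp
  obtain c0 where c0: "\<And>c. c \<noteq> c0 \<Longrightarrow> W 0 c x" using start by blast
  obtain w where w: "\<And>cs c. length cs = n \<Longrightarrow> cs \<noteq> w \<Longrightarrow> W n c (fold T cs (T c0 x))"
    using Suc.IH by blast
  have "W (Suc n) c (fold T cs x)" if "length cs = Suc n" "cs \<noteq> c0 # w" for cs c
  proof -
    obtain b bs where cs: "cs = b # bs" "length bs = n" using \<open>length cs = Suc n\<close> by (cases cs) auto
    show ?thesis
    proof (cases "b = c0")
      case True
      then show ?thesis using w mono that cs by auto
    next
      case False
      then have "\<forall>c. W 1 c (T b x)" using c0 step by auto
      from persist[OF this, of bs c] show ?thesis using cs by simp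
    qed
  qed
  then show ?case by blast
qed

locale schottky_family =
  fixes bp :: "'a::metric_space" and f :: "'i::finite \<Rightarrow> 'a \<Rightarrow> 'a" and e :: "'i \<Rightarrow> int"
    and C R :: real and r :: int
  assumes isometry_generator: "isometry (f c)"
    and C_nonneg: "0 \<le> C" and r_nonneg: "0 \<le> r"
    and constricting: "constricting C (range (orbit_map bp (f c)))"
    and behrstock: "c \<noteq> c' \<Longrightarrow> p \<in> proj (range (orbit_map bp (f c))) x \<Longrightarrow>
      q \<in> proj (range (orbit_map bp (f c'))) x \<Longrightarrow> dist bp p \<le> R \<or> dist bp q \<le> R"
    and index_bound: "dist bp (orbit_map bp (f c) i) \<le> R \<Longrightarrow> \<bar>i\<bar> \<le> r"
    and exponent_large: "2 * r < e c"
    and separation: "e c - 2 * r \<le> j - i \<Longrightarrow>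
      C < dist (orbit_map bp (f c) i) (orbit_map bp (f c) j)"
begin

definition axis :: "'i \<Rightarrow> 'a set" where "axis c = range (orbit_map bp (f c))"

definition letter :: "'i \<Rightarrow> 'a \<Rightarrow> 'a" where "letter c = zpow (f c) (e c)"

definition exponent_bound :: int where "exponent_bound = Max (range e)"

text \<open>
  The sign \<open>\<sigma>\<close> is \<open>1\<close> for points reached by the past of a word and \<open>-1\<close> for points reached by its
  future. The upper bound says that the projection of \<open>x\<close> does not lie ahead; the lower bound keeps it
  at bounded distance from the base point after \<open>k\<close> letters.
\<close>

definition facing :: "int \<Rightarrow> nat \<Rightarrow> 'i \<Rightarrow> 'a \<Rightarrow> bool" where
  "facing \<sigma> k c x \<longleftrightarrow> (\<forall>i. orbit_map bp (f c) i \<in> proj (axis c) x \<longrightarrow>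
      \<sigma> * i \<in> {- r - int k * exponent_bound..r})"

definition shift :: "int \<Rightarrow> 'i \<Rightarrow> 'a \<Rightarrow> 'a" where "shift \<sigma> c = zpow (f c) (- \<sigma> * e c)"

lemma exponent_le_bound: "e c \<le> exponent_bound"
  by (simp add: exponent_bound_def)

lemma exponent_bound_nonneg: "0 \<le> exponent_bound"
  using exponent_large[of undefined] exponent_le_bound[of undefined] r_nonneg by linarith

lemma ex_proj_index: obtains i where "orbit_map bp (f c) i \<in> proj (axis c) x"
  using constricting_proj_nonempty[OF constricting, of c x] unfolding axis_def proj_def by blast

lemma facing_of_far_proj:
  assumes sign: "\<sigma> \<in> {1, -1}" and i: "orbit_map bp (f c) i \<in> proj (axis c) x" "r < \<bar>i\<bar>"
    and "c' \<noteq> c"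
  shows "facing \<sigma> k c' x"
  unfolding facing_def
proof (intro allI impI)
  fix j assume j: "orbit_map bp (f c') j \<in> proj (axis c') x"
  have "\<not> dist bp (orbit_map bp (f c) i) \<le> R" using index_bound[of c i] i(2) by linarith
  then have "dist bp (orbit_map bp (f c') j) \<le> R"
    using behrstock i(1) j \<open>c' \<noteq> c\<close> unfolding axis_def by blast
  then have "\<bar>j\<bar> \<le> r" by (rule index_bound)
  then have "- r \<le> \<sigma> * j" "\<sigma> * j \<le> r" using sign by auto
  moreover have "0 \<le> int k * exponent_bound" using exponent_bound_nonneg by simp
  ultimately show "\<sigma> * j \<in> {- r - int k * exponent_bound..r}" by simp
qed

lemma facing_start:
  assumes sign: "\<sigma> \<in> {1, -1}" shows "\<exists>c0. \<forall>c. c \<noteq> c0 \<longrightarrow> facing \<sigma> 0 c x"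
proof (cases "\<forall>c. facing \<sigma> 0 c x")
  case False
  then obtain c0 i where i: "orbit_map bp (f c0) i \<in> proj (axis c0) x" "\<sigma> * i \<notin> {- r..r}"
    by (auto simp: facing_def)
  then have "r < \<bar>i\<bar>" using sign by auto
  with facing_of_far_proj[OF sign i(1)] show ?thesis by blast
qed blast

lemma facing_step:
  assumes sign: "\<sigma> \<in> {1, -1}" and facing_x: "facing \<sigma> k c x"
  shows "facing \<sigma> (Suc k) c' (shift \<sigma> c x)"
proof -
  have index: "- r - int k * exponent_bound - e c \<le> \<sigma> * i \<and> \<sigma> * i \<le> r - e c"
    if "orbit_map bp (f c) i \<in> proj (axis c) (shift \<sigma> c x)" for i
  proof -
    have "orbit_map bp (f c) (i + \<sigma> * e c) \<in> proj (axis c) x"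
      using that mem_proj_orbit_zpow[OF isometry_generator, of bp c "i + \<sigma> * e c" "- \<sigma> * e c" x]
      by (simp add: axis_def shift_def)
    then have "\<sigma> * (i + \<sigma> * e c) \<in> {- r - int k * exponent_bound..r}"
      using facing_x by (simp add: facing_def)
    moreover have "\<sigma> * (i + \<sigma> * e c) = \<sigma> * i + e c" using sign by auto
    ultimately show ?thesis unfolding atLeastAtMost_iff by linarith
  qed
  show ?thesis
  proof (cases "c' = c")
    case True
    have "- r - int (Suc k) * exponent_bound \<le> - r - int k * exponent_bound - e c" "r - e c \<le> r"
      using exponent_large[of c] exponent_le_bound[of c] r_nonneg by (auto simp: algebra_simps)
    with index show ?thesis unfolding True facing_def atLeastAtMost_iff by (meson order_trans)
  next
    case False
    obtain i where i: "orbit_map bp (f c) i \<in> proj (axis c) (shift \<sigma> c x)" by (rule ex_proj_index)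
    then have "r < \<bar>i\<bar>" using index[OF i] sign exponent_large[of c] by auto
    with facing_of_far_proj[OF sign i] False show ?thesis by blast
  qed
qed

lemma facing_Suc: "facing \<sigma> k c x \<Longrightarrow> facing \<sigma> (Suc k) c x"
  using exponent_bound_nonneg unfolding facing_def by (fastforce simp: algebra_simps)

lemma ex_exceptional_shift_word:
  assumes "\<sigma> \<in> {1, -1}"
  shows "\<exists>w. \<forall>cs c. length cs = n \<longrightarrow> cs \<noteq> w \<longrightarrow> facing \<sigma> n c (fold (shift \<sigma>) cs x)"
  using facing_start[OF assms] facing_step[OF assms] facing_Suc by (rule ex_exceptional_word)

lemma shift_minus: "shift (-1) = letter"
  by (simp add: fun_eq_iff shift_def letter_def)

lemma ex_exceptional_past_word:
  "\<exists>w. \<forall>cs c. length cs = n \<longrightarrow> cs \<noteq> w \<longrightarrow> facing 1 n c (fold (shift 1) cs x)"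
  by (rule ex_exceptional_shift_word) simp

lemma ex_exceptional_future_word:
  "\<exists>w. \<forall>cs c. length cs = n \<longrightarrow> cs \<noteq> w \<longrightarrow> facing (-1) n c (foldr letter cs y)"
proof -
  obtain w where "\<And>cs c. length cs = n \<Longrightarrow> cs \<noteq> w \<Longrightarrow> facing (-1) n c (fold letter cs y)"
    using ex_exceptional_shift_word[of "-1" n y] unfolding shift_minus by auto
  then have "facing (-1) n c (foldr letter cs y)" if "length cs = n" "cs \<noteq> rev w" for cs c
    using that by (metis foldr_conv_fold length_rev rev_rev_ident)
  then show ?thesis by blast
qed

lemma isometry_letter: "isometry (letter c)"
  by (simp add: letter_def isometry_zpow isometry_generator)

lemma inj_letter: "inj letter"
proof (rule injI, rule ccontr)
  fix c c' assume eq: "letter c = letter c'" and "c \<noteq> c'"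
  have orbit: "letter c bp = orbit_map bp (f c) (e c)" for c by (simp add: letter_def orbit_map_def)
  then have "letter c bp \<in> proj (range (orbit_map bp (f c))) (letter c bp)" for c
    by (auto simp: mem_proj_iff)
  from behrstock[OF \<open>c \<noteq> c'\<close> this[of c]] this[of c'] have "dist bp (letter c bp) \<le> R"
    unfolding eq by blast
  then have "\<bar>e c\<bar> \<le> r" unfolding orbit by (rule index_bound)
  then show False using exponent_large[of c] r_nonneg by linarith
qed

lemma dist_shift: "dist (shift 1 c x) y = dist x (letter c y)"
proof -
  have "letter c (shift 1 c x) = x"
    using zpow_add[OF isometry_bij[OF isometry_generator], of c "e c" "- e c"]
    by (simp add: letter_def shift_def fun_eq_iff zpow_def)
  then show ?thesis using isometry_dist[OF isometry_letter] by metis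
qed

lemma dist_fold_shift: "dist (fold (shift 1) cs x) y = dist x (foldr letter cs y)"
  by (induction cs arbitrary: x) (simp_all add: dist_shift)

definition axis_radius :: "nat \<Rightarrow> 'i \<Rightarrow> real" where
  "axis_radius n c = Max ((\<lambda>i. dist bp (orbit_map bp (f c) i)) `
     {- r - int n * exponent_bound..r + int n * exponent_bound})"

lemma dist_proj_facing_le:
  assumes "\<sigma> \<in> {1, -1}" "facing \<sigma> n c x" "orbit_map bp (f c) i \<in> proj (axis c) x"
  shows "dist bp (orbit_map bp (f c) i) \<le> axis_radius n c"
proof -
  have "\<sigma> * i \<in> {- r - int n * exponent_bound..r}" using assms by (simp add: facing_def)
  moreover have "0 \<le> int n * exponent_bound" using exponent_bound_nonneg by simp
  ultimately have "i \<in> {- r - int n * exponent_bound..r + int n * exponent_bound}"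
    using \<open>\<sigma> \<in> {1, -1}\<close> by auto
  then show ?thesis unfolding axis_radius_def by (intro Max_ge) auto
qed

lemma dist_letter_ge:
  assumes facing_x: "facing 1 n c x" and facing_y: "facing (-1) n c y"
  shows "dist x bp + dist bp y \<le> dist x (letter c y) + (C + 2 * axis_radius n c)"
proof -
  obtain i where i: "orbit_map bp (f c) i \<in> proj (axis c) x" by (rule ex_proj_index)
  obtain j where j: "orbit_map bp (f c) j \<in> proj (axis c) y" by (rule ex_proj_index)
  let ?p = "orbit_map bp (f c) i" and ?q = "orbit_map bp (f c) j" and ?q' = "orbit_map bp (f c) (j + e c)"
  have "?q' \<in> proj (axis c) (letter c y)"
    using j mem_proj_orbit_zpow[OF isometry_generator, of bp c j "e c" y]
    by (simp add: axis_def letter_def)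
  moreover have "i \<le> r" "- r \<le> j" using facing_x facing_y i j by (auto simp: facing_def)
  then have "C < dist ?p ?q'" by (intro separation) linarith
  ultimately have "dist x ?p + dist ?p ?q' + dist ?q' (letter c y) \<le> dist x (letter c y) + C"
    using constricting_dist[OF constricting] i unfolding axis_def by blast
  moreover have "dist ?q' (letter c y) = dist ?q y"
    using zpow_orbit_map[OF isometry_bij[OF isometry_generator], of c "e c" bp j]
      isometry_dist[OF isometry_letter] by (metis letter_def)
  moreover have "dist bp ?p \<le> axis_radius n c" "dist bp ?q \<le> axis_radius n c"
    using dist_proj_facing_le[OF _ facing_x i] dist_proj_facing_le[OF _ facing_y j] by simp_all
  moreover have "dist x bp \<le> dist x ?p + dist bp ?p" "dist bp y \<le> dist bp ?q + dist ?q y"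
    by (rule dist_triangle2, rule dist_triangle)
  ultimately show ?thesis using zero_le_dist[of ?p ?q'] by linarith
qed

definition word_radius :: "nat \<Rightarrow> real" where
  "word_radius n = Max ((\<lambda>cs. dist bp (foldr letter cs bp)) ` {cs. length cs = n})"

lemma dist_word_le: "length cs = n \<Longrightarrow> dist bp (foldr letter cs bp) \<le> word_radius n"
  using finite_lists_length_eq[of "UNIV :: 'i set" n] unfolding word_radius_def
  by (intro Max_ge) auto

definition additivity_defect :: "nat \<Rightarrow> 'i \<Rightarrow> real" where
  "additivity_defect n c = C + 2 * axis_radius n c + 2 * word_radius n"

lemma additivity_defect_nonneg: "0 \<le> additivity_defect n c"
proof -
  have "0 \<in> {- r - int n * exponent_bound..r + int n * exponent_bound}"
    using r_nonneg mult_nonneg_nonneg[OF of_nat_0_le_iff exponent_bound_nonneg, of n] by simp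
  then have "dist bp (orbit_map bp (f c) 0) \<le> axis_radius n c"
    unfolding axis_radius_def by (intro Max_ge) auto
  then have "0 \<le> axis_radius n c" by (simp add: orbit_map_0)
  moreover have "0 \<le> word_radius n"
    by (rule order_trans[OF zero_le_dist dist_word_le[of "replicate n c"]]) simp
  ultimately show ?thesis using C_nonneg by (simp add: additivity_defect_def)
qed

lemma dist_word_ge:
  assumes "length bs = n" "length cs = n"
    and "facing 1 n c (fold (shift 1) bs x)" "facing (-1) n c (foldr letter cs y)"
  shows "dist x bp + dist bp y
    \<le> dist x (foldr letter bs (letter c (foldr letter cs y))) + additivity_defect n c"
proof -
  let ?x = "fold (shift 1) bs x" and ?y = "foldr letter cs y"
  have "dist ?x bp + dist bp ?y \<le> dist ?x (letter c ?y) + (C + 2 * axis_radius n c)"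
    using assms(3,4) by (rule dist_letter_ge)
  moreover have "dist x bp - word_radius n \<le> dist ?x bp"
    using dist_word_le[OF assms(1)] dist_triangle2[of x bp "foldr letter bs bp"]
    by (simp add: dist_fold_shift)
  moreover have "dist bp y - word_radius n \<le> dist bp ?y"
  proof -
    have "dist (foldr letter cs bp) ?y = dist bp y"
      by (rule isometry_dist[OF isometry_foldr]) (simp add: isometry_letter)
    then show ?thesis
      using dist_word_le[OF assms(2)] dist_triangle3[of "foldr letter cs bp" ?y bp]
      by linarith
  qed
  ultimately show ?thesis by (simp add: dist_fold_shift additivity_defect_def)
qed

end

lemma contracting_axis_mono:
  assumes "contracting_axis K f" "0 < K" "K \<le> K'"
  shows "contracting_axis K' f"
proof -
  have "\<bar>n\<bar> / K' - K' \<le> \<bar>n\<bar> / K - K" "K * \<bar>n\<bar> + K \<le> K' * \<bar>n\<bar> + K'" for n :: real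
    using assms by (intro diff_mono add_mono divide_left_mono mult_right_mono; simp)+
  then have "quasigeodesic K' f"
    using assms(1) unfolding contracting_axis_def quasigeodesic_def by (meson order_trans)
  then show ?thesis
    using assms unfolding contracting_axis_def by (meson order_trans order_less_le_trans)
qed

lemma uniformly_contracting_axes:
  fixes f :: "'i::finite \<Rightarrow> 'a::metric_space \<Rightarrow> 'a"
  assumes "\<And>c. contracting bp (f c)"
  shows "\<exists>K>0. \<forall>c. contracting_axis K (orbit_map bp (f c))"
proof -
  obtain k where k: "\<And>c. 0 < k c" "\<And>c. contracting_axis (k c) (orbit_map bp (f c))"
    using assms unfolding contracting_def by metis
  have k_le: "k c \<le> Max (range k)" for c by simp
  have "0 < Max (range k)" using k(1) k_le by (rule order_less_le_trans[of _ "k undefined"])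
  moreover have "contracting_axis (Max (range k)) (orbit_map bp (f c))" for c
    by (rule contracting_axis_mono[OF k(2,1) k_le])
  ultimately show ?thesis by blast
qed

lemma independent_bounded_projections:
  fixes f :: "'i::finite \<Rightarrow> 'a::metric_space \<Rightarrow> 'a"
  assumes "\<forall>c c'. c \<noteq> c' \<longrightarrow> independent bp (f c) (f c')"
  shows "\<exists>R. \<forall>c c'. c \<noteq> c' \<longrightarrow>
    proj_set (range (orbit_map bp (f c))) (range (orbit_map bp (f c'))) \<subseteq> cball bp R"
proof -
  define P where "P c c' = proj_set (range (orbit_map bp (f c))) (range (orbit_map bp (f c')))" for c c'
  have "bounded (\<Union>c. \<Union>c'\<in>- {c}. P c c')"
    using assms by (intro bounded_UN finite ballI) (auto simp: independent_def P_def)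
  then have "\<exists>R. \<forall>c c'. c \<noteq> c' \<longrightarrow> P c c' \<subseteq> cball bp R"
    unfolding bounded_any_center[of _ bp] by fastforce
  then show ?thesis by (simp only: P_def)
qed

lemma independent_schottky_family:
  fixes bp :: "'a::metric_space" and f :: "'i::finite \<Rightarrow> 'a \<Rightarrow> 'a"
  assumes geodesic: "geodesic_space TYPE('a)" and iso: "\<And>c. isometry (f c)"
    and contracting: "\<And>c. contracting bp (f c)"
    and independent: "\<forall>c c'. c \<noteq> c' \<longrightarrow> independent bp (f c) (f c')"
  shows "\<exists>C R r T. \<forall>e. (\<forall>c. T \<le> e c) \<longrightarrow> schottky_family bp f e C R r"
proof -
  let ?A = "\<lambda>c. range (orbit_map bp (f c))"
  obtain K where K_pos: "0 < K" and axis: "\<forall>c. contracting_axis K (orbit_map bp (f c))"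
    using uniformly_contracting_axes[of bp f, OF contracting] by (elim exE conjE)
  obtain R0 where bounded_proj: "\<forall>c c'. c \<noteq> c' \<longrightarrow> proj_set (?A c) (?A c') \<subseteq> cball bp R0"
    using independent_bounded_projections[OF independent] by (rule exE)
  define C where "C = 8 * K"
  define R where "R = R0 + 2 * C"
  define r where "r = max 0 \<lceil>K * (R + K)\<rceil>"
  define T where "T = 2 * r + max 0 \<lceil>K * (C + K)\<rceil> + 1"
  have C_nonneg: "0 \<le> C" using K_pos by (simp add: C_def)
  have constricting: "constricting C (?A c)" for c
    unfolding C_def by (rule contracting_axis_constricting[OF geodesic axis[rule_format] K_pos])
  have index: "\<bar>real_of_int (i - j)\<bar> \<le> K * (S + K)"
    if "dist (orbit_map bp (f c) i) (orbit_map bp (f c) j) \<le> S" for c i j S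
    using axis K_pos that unfolding contracting_axis_def by (intro quasigeodesic_index_diff_le) auto
  have "schottky_family bp f e C R r" if e: "\<forall>c. T \<le> e c" for e
  proof
    show "isometry (f c)" "0 \<le> C" "0 \<le> r" "constricting C (?A c)" for c
      by (auto simp: iso C_nonneg constricting r_def)
    show "dist bp p \<le> R \<or> dist bp q \<le> R"
      if "c \<noteq> c'" "p \<in> proj (?A c) x" "q \<in> proj (?A c') x" for c c' p q x
      unfolding R_def using that bounded_proj
      by (intro behrstock_inequality[OF constricting constricting C_nonneg]) simp_all
    show "\<bar>i\<bar> \<le> r" if "dist bp (orbit_map bp (f c) i) \<le> R" for c i
      using index[of c 0 i R] that unfolding r_def orbit_map_0 by linarith
    show "2 * r < e c" for c using e[rule_format, of c] by (simp add: T_def)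
    show "C < dist (orbit_map bp (f c) i) (orbit_map bp (f c) j)" if "e c - 2 * r \<le> j - i" for c i j
      using index[of c j i C] that e[rule_format, of c]
      unfolding T_def dist_commute[of "orbit_map bp (f c) i"] by linarith
  qed
  then show ?thesis by blast
qed

section \<open>Convolutions and their moments\<close>

definition conv :: "('a \<Rightarrow> 'a) pmf \<Rightarrow> ('a \<Rightarrow> 'a) pmf \<Rightarrow> ('a \<Rightarrow> 'a) pmf" where
  "conv p q = bind_pmf p (\<lambda>g. map_pmf (\<lambda>h. g \<circ> h) q)"

lemma conv_return_id:
  "conv (return_pmf id) p = p" "conv p (return_pmf id) = p"
  by (simp_all add: conv_def bind_return_pmf bind_return_pmf' id_def comp_def)

lemma conv_assoc: "conv (conv p q) s = conv p (conv q s)"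
  by (simp add: conv_def map_bind_pmf bind_assoc_pmf bind_map_pmf map_pmf_comp comp_def)

lemma conv_map_pmf:
  "conv (map_pmf f p) q = bind_pmf p (\<lambda>c. map_pmf (\<lambda>h. f c \<circ> h) q)"
  by (simp add: conv_def bind_map_pmf)

lemma set_pmf_conv: "set_pmf (conv p q) = {g \<circ> h |g h. g \<in> set_pmf p \<and> h \<in> set_pmf q}"
  by (auto simp: conv_def)

lemma nn_integral_conv:
  "(\<integral>\<^sup>+v. F v \<partial>conv p q) = (\<integral>\<^sup>+g. \<integral>\<^sup>+h. F (g \<circ> h) \<partial>q \<partial>p)"
  by (simp add: conv_def)

lemma nn_integral_pmf_commute:
  "(\<integral>\<^sup>+x. \<integral>\<^sup>+y. F x y \<partial>measure_pmf q \<partial>measure_pmf p) = (\<integral>\<^sup>+y. \<integral>\<^sup>+x. F x y \<partial>measure_pmf p \<partial>measure_pmf q)"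
  using nn_integral_pair_pmf'[of p q "case_prod F"] nn_integral_pair_pmf'[of q p "\<lambda>(y, x). F x y"]
  by (subst (asm) pair_commute_pmf) (simp add: case_prod_beta)

lemma nn_integral_pmf_add_const:
  "(\<integral>\<^sup>+x. F x + c \<partial>measure_pmf p) = (\<integral>\<^sup>+x. F x \<partial>measure_pmf p) + c"
  by (simp add: nn_integral_add measure_pmf.emeasure_space_1)

lemma conv_pow_Suc: "conv_pow \<mu> (Suc n) = conv (conv_pow \<mu> n) \<mu>"
  by (simp add: conv_def)

declare conv_pow.simps(2) [simp del]

lemma conv_pow_add: "conv_pow \<mu> (m + n) = conv (conv_pow \<mu> m) (conv_pow \<mu> n)"
proof (induction n)
  case (Suc n)
  then show ?case by (simp add: conv_pow_Suc conv_assoc)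
qed (simp add: conv_return_id)

lemma conv_pow_Suc_left: "conv_pow \<mu> (Suc n) = conv \<mu> (conv_pow \<mu> n)"
  using conv_pow_add[of \<mu> 1 n] conv_pow_Suc[of \<mu> 0] by (simp add: conv_return_id)

lemma conv_pow_mult: "conv_pow \<mu> (m * n) = conv_pow (conv_pow \<mu> m) n"
  by (induction n) (simp_all add: conv_pow_add conv_pow_Suc_left)

lemma map_foldr_replicate_pmf:
  "map_pmf (foldr f) (replicate_pmf n p) = conv_pow (map_pmf f p) n"
proof (induction n)
  case (Suc n)
  have "map_pmf (foldr f) (replicate_pmf (Suc n) p)
      = bind_pmf p (\<lambda>c. map_pmf (\<lambda>h. f c \<circ> h) (map_pmf (foldr f) (replicate_pmf n p)))"
    by (simp add: map_bind_pmf map_pmf_comp bind_return_pmf flip: map_pmf_def)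
  then show ?case by (simp add: Suc.IH conv_pow_Suc_left conv_map_pmf)
qed (simp add: id_def)

lemma isometry_conv_pow:
  assumes "\<forall>g\<in>set_pmf \<mu>. isometry g"
  shows "\<forall>g\<in>set_pmf (conv_pow \<mu> n). isometry g"
proof (induction n)
  case (Suc n)
  then show ?case
    using assms by (auto simp: conv_pow_Suc set_pmf_conv intro!: isometry_comp)
qed (simp add: isometry_id[unfolded id_def])

definition first_moment :: "'a::metric_space \<Rightarrow> ('a \<Rightarrow> 'a) pmf \<Rightarrow> ennreal" where
  "first_moment bp p = (\<integral>\<^sup>+g. ennreal (dist bp (g bp)) \<partial>p)"

lemma first_moment_conv_le:
  assumes "\<forall>g\<in>set_pmf p. isometry g"
  shows "first_moment bp (conv p q) \<le> first_moment bp p + first_moment bp q"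
proof -
  have "first_moment bp (conv p q) = (\<integral>\<^sup>+g. \<integral>\<^sup>+h. ennreal (dist bp (g (h bp))) \<partial>q \<partial>p)"
    by (simp add: first_moment_def nn_integral_conv)
  also have "\<dots> \<le> (\<integral>\<^sup>+g. \<integral>\<^sup>+h. ennreal (dist bp (h bp)) + ennreal (dist bp (g bp)) \<partial>q \<partial>p)"
  proof (rule nn_integral_mono_AE, unfold AE_measure_pmf_iff, intro ballI nn_integral_mono)
    fix g h assume "g \<in> set_pmf p"
    then have "dist (g bp) (g (h bp)) = dist bp (h bp)" using assms isometry_dist by blast
    then have "dist bp (g (h bp)) \<le> dist bp (h bp) + dist bp (g bp)"
      using dist_triangle[of bp "g (h bp)" "g bp"] by simp
    then show "ennreal (dist bp (g (h bp))) \<le> ennreal (dist bp (h bp)) + ennreal (dist bp (g bp))"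
      by (simp add: ennreal_leI flip: ennreal_plus)
  qed
  also have "\<dots> = first_moment bp p + first_moment bp q"
    by (simp add: first_moment_def nn_integral_add nn_integral_pmf_add_const
        measure_pmf.emeasure_space_1 add.commute)
  finally show ?thesis .
qed

lemma first_moment_conv_pow_le:
  assumes "\<forall>g\<in>set_pmf \<mu>. isometry g"
  shows "first_moment bp (conv_pow \<mu> n) \<le> of_nat n * first_moment bp \<mu>"
proof (induction n)
  case (Suc n)
  have "first_moment bp (conv_pow \<mu> (Suc n)) \<le> first_moment bp (conv_pow \<mu> n) + first_moment bp \<mu>"
    unfolding conv_pow_Suc using assms by (intro first_moment_conv_le isometry_conv_pow)
  also have "\<dots> \<le> of_nat n * first_moment bp \<mu> + first_moment bp \<mu>"
    using Suc.IH by (rule add_right_mono)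
  finally show ?case by (simp add: distrib_right add.commute)
qed (simp add: first_moment_def)

lemma first_moment_conv_pow_finite:
  assumes "\<forall>g\<in>set_pmf \<mu>. isometry g" "first_moment bp \<mu> < \<infinity>"
  shows "first_moment bp (conv_pow \<mu> n) < \<infinity>"
  by (rule le_less_trans[OF first_moment_conv_pow_le[OF assms(1)]])
    (use assms(2) in \<open>simp add: ennreal_mult_less_top of_nat_less_top\<close>)

section \<open>Gromov products along a walk with good blocks\<close>

definition gromov_product :: "'a::metric_space \<Rightarrow> 'a \<Rightarrow> 'a \<Rightarrow> real" where
  "gromov_product z x y = (dist z x + dist z y - dist x y) / 2"

lemma gromov_product_nonneg: "0 \<le> gromov_product z x y"
  using dist_triangle3[of x y z] by (simp add: gromov_product_def)

lemma gromov_product_le: "gromov_product z x y \<le> dist z y"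
  using dist_triangle2[of z x y] by (simp add: gromov_product_def dist_commute)

lemma gromov_product_isometry_le:
  assumes "isometry g"
  shows "gromov_product z x (g y) \<le> gromov_product z (inv g x) y + dist z (g z)"
proof -
  have "dist z (g y) \<le> dist z (g z) + dist z y"
    using dist_triangle[of z "g y" "g z"] isometry_dist[OF assms] by simp
  moreover have "dist z x \<le> dist z (inv g x) + dist z (g z)"
    using dist_triangle2[of x z "g z"] isometry_dist_inv[OF assms, of x z] by (simp add: dist_commute)
  moreover have "dist (inv g x) y = dist x (g y)" by (rule isometry_dist_inv[OF assms])
  ultimately show ?thesis by (simp add: gromov_product_def field_simps)
qed

lemma gromov_product_good_isometry_le:
  assumes "isometry g" "dist x z + dist z y \<le> dist x (g y) + C"
  shows "2 * gromov_product z x (g y) \<le> C + dist z (g z)"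
proof -
  have "dist z (g y) \<le> dist z (g z) + dist z y"
    using dist_triangle[of z "g y" "g z"] isometry_dist[OF assms(1)] by simp
  with assms(2) show ?thesis by (simp add: gromov_product_def dist_commute)
qed

definition mean_gromov_product :: "'a::metric_space \<Rightarrow> 'a \<Rightarrow> ('a \<Rightarrow> 'a) pmf \<Rightarrow> ennreal" where
  "mean_gromov_product bp x p = (\<integral>\<^sup>+v. ennreal (gromov_product bp x (v bp)) \<partial>p)"

locale block_walk =
  fixes bp :: "'a::metric_space" and \<beta> :: "'b pmf" and act :: "'b \<Rightarrow> 'a \<Rightarrow> 'a"
    and S :: "'b set" and left_bad :: "'a \<Rightarrow> 'b \<Rightarrow> bool" and right_bad :: "'b \<Rightarrow> 'a \<Rightarrow> bool"
    and C M :: real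
  assumes isometry_act: "c \<in> set_pmf \<beta> \<Longrightarrow> isometry (act c)"
    and finite_S: "finite S" and S_nonempty: "S \<noteq> {}" and S_subset: "S \<subseteq> set_pmf \<beta>"
    and card_left_bad: "16 * card {c\<in>S. left_bad x c} \<le> card S"
    and card_right_bad: "16 * card {c\<in>S. right_bad c y} \<le> card S"
    and good_block: "c \<in> S \<Longrightarrow> \<not> left_bad x c \<Longrightarrow> \<not> right_bad c y \<Longrightarrow>
      dist x bp + dist bp y \<le> dist x (act c y) + C"
    and C_nonneg: "0 \<le> C" and M_nonneg: "0 \<le> M"
    and first_moment_act: "first_moment bp (map_pmf act \<beta>) \<le> ennreal M"
begin

abbreviation block_length :: "'b \<Rightarrow> real" where "block_length c \<equiv> dist bp (act c bp)"

definition min_mass :: real where "min_mass = Min (pmf \<beta> ` S)"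

text \<open>
  The weight has mean less than 1 when few blocks are bad, while \<open>weight b c * weight b' c \<ge> 1\<close>
  unless \<open>c\<close> is a block of \<open>S\<close> that is good for both \<open>b\<close> and \<open>b'\<close>. The factor \<open>min_mass / pmf \<beta> c\<close>
  makes all blocks of \<open>S\<close> count equally, whatever their probabilities.
\<close>

definition weight :: "('b \<Rightarrow> bool) \<Rightarrow> 'b \<Rightarrow> real" where
  "weight b c = (if c \<in> S then 1 + min_mass / pmf \<beta> c * (if b c then 3 else -3/4) else 1)"

definition decay :: real where "decay = 1 - min_mass * card S / 2"

lemma min_mass_pos: "0 < min_mass"
  using finite_S S_nonempty S_subset by (auto simp: min_mass_def pmf_positive_iff)

lemma min_mass_le: "c \<in> S \<Longrightarrow> min_mass \<le> pmf \<beta> c"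
  using finite_S by (simp add: min_mass_def)

lemma decay_bounds: "0 \<le> decay" "decay < 1"
proof -
  have "min_mass * card S = (\<Sum>c\<in>S. min_mass)" by simp
  also have "\<dots> \<le> (\<Sum>c\<in>S. pmf \<beta> c)" by (rule sum_mono) (rule min_mass_le)
  also have "\<dots> = measure_pmf.prob \<beta> S" using finite_S by (simp add: measure_measure_pmf_finite)
  also have "\<dots> \<le> 1" by simp
  finally show "0 \<le> decay" by (simp add: decay_def)
  show "decay < 1"
    using min_mass_pos finite_S S_nonempty by (simp add: decay_def card_gt_0_iff)
qed

lemma weight_cases:
  obtains t where "0 \<le> t" "t \<le> 1" "\<And>b. weight b c = (if b c then 1 + 3 * t else 1 - 3/4 * t)"
proof
  let ?t = "if c \<in> S then min_mass / pmf \<beta> c else 0"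
  show "0 \<le> ?t" using min_mass_pos by simp
  show "?t \<le> 1" using min_mass_le[of c] min_mass_pos by auto
  show "weight b c = (if b c then 1 + 3 * ?t else 1 - 3/4 * ?t)" for b
    by (simp add: weight_def)
qed

lemma weight_bounds: "0 \<le> weight b c" "weight b c \<le> 4"
proof -
  obtain t where "0 \<le> t" "t \<le> 1" "\<And>b. weight b c = (if b c then 1 + 3 * t else 1 - 3/4 * t)"
    using weight_cases[of c] by blast
  then show "0 \<le> weight b c" "weight b c \<le> 4" by simp_all
qed

lemma one_le_weight_mult:
  assumes "c \<in> S \<Longrightarrow> b c \<or> b' c"
  shows "1 \<le> weight b c * weight b' c"
proof (cases "c \<in> S")
  case True
  obtain t where t_bounds: "0 \<le> t" "t \<le> 1"
    and weight: "\<And>b. weight b c = (if b c then 1 + 3 * t else 1 - 3/4 * t)"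
    using weight_cases[of c] by blast
  have "0 \<le> 9/4 * (t * (1 - t))" using t_bounds by simp
  also have "\<dots> = (1 + 3 * t) * (1 - 3/4 * t) - 1" by (simp add: field_simps)
  finally have "1 \<le> (1 + 3 * t) * (1 - 3/4 * t)" by simp
  moreover have "1 \<le> (1 + 3 * t) * (1 + 3 * t)" using t_bounds by (simp add: algebra_simps)
  ultimately show ?thesis using assms[OF True] by (auto simp: weight mult.commute)
qed (simp add: weight_def)

lemma integrable_weight: "integrable \<beta> (weight b)"
  by (rule measure_pmf.integrable_const_bound[where B = 4]) (simp_all add: weight_bounds)

lemma expectation_weight:
  "measure_pmf.expectation \<beta> (weight b)
     = 1 + min_mass * (15/4 * card {c\<in>S. b c} - 3/4 * card S)"
proof -
  have "measure_pmf.expectation \<beta> (weight b) - 1 = measure_pmf.expectation \<beta> (\<lambda>c. weight b c - 1)"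
    using integrable_weight by (simp add: measure_pmf.prob_space)
  also have "\<dots> = (\<Sum>c\<in>S. (weight b c - 1) * pmf \<beta> c)"
    using finite_S by (intro integral_measure_pmf_real) (auto simp: weight_def split: if_splits)
  also have "\<dots> = (\<Sum>c\<in>S. min_mass * ((if b c then 15/4 else 0) - 3/4))"
  proof (rule sum.cong)
    fix c assume "c \<in> S"
    then have "pmf \<beta> c \<noteq> 0" using min_mass_le[of c] min_mass_pos by auto
    with \<open>c \<in> S\<close> show "(weight b c - 1) * pmf \<beta> c = min_mass * ((if b c then 15/4 else 0) - 3/4)"
      by (simp add: weight_def)
  qed simp
  also have "\<dots> = min_mass * (\<Sum>c\<in>S. (if b c then 15/4 else 0) - 3/4)"
    by (simp only: sum_distrib_left)
  also have "(\<Sum>c\<in>S. (if b c then 15/4 else 0) - 3/4 :: real) = 15/4 * card {c\<in>S. b c} - 3/4 * card S"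
    using finite_S by (simp add: sum_subtractf sum.If_cases Int_def)
  finally show ?thesis by simp
qed

lemma nn_integral_weight_le:
  assumes "16 * card {c\<in>S. b c} \<le> card S"
  shows "(\<integral>\<^sup>+c. ennreal (weight b c) \<partial>\<beta>) \<le> ennreal decay"
proof -
  have "16 * real (card {c\<in>S. b c}) \<le> real (card S)"
    using assms by (metis of_nat_le_iff of_nat_mult of_nat_numeral)
  then have "15/4 * real (card {c\<in>S. b c}) - 3/4 * real (card S) \<le> - (real (card S) / 2)"
    using of_nat_0_le_iff[of "card S"] by linarith
  then have "measure_pmf.expectation \<beta> (weight b) \<le> 1 + min_mass * - (real (card S) / 2)"
    unfolding expectation_weight using min_mass_pos by (intro add_left_mono mult_left_mono) auto
  then show ?thesis
    by (simp add: nn_integral_eq_integral[OF integrable_weight] weight_bounds decay_def ennreal_leI)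
qed

primrec left_cost :: "'a \<Rightarrow> 'b list \<Rightarrow> real" where
  "left_cost x [] = 0"
| "left_cost x (c # cs) = block_length c + weight (left_bad x) c * left_cost (inv (act c) x) cs"

primrec right_cost :: "'a \<Rightarrow> 'b list \<Rightarrow> real" where
  "right_cost y [] = 0"
| "right_cost y (c # cs) =
     block_length c + weight (\<lambda>c. right_bad c (foldr act cs y)) c * right_cost y cs"

lemma left_cost_nonneg: "0 \<le> left_cost x cs"
  by (induction cs arbitrary: x) (simp_all add: weight_bounds)

lemma right_cost_nonneg: "0 \<le> right_cost y cs"
  by (induction cs) (simp_all add: weight_bounds)

definition mixed_cost :: "real \<Rightarrow> real \<Rightarrow> 'a \<Rightarrow> 'a \<Rightarrow> 'b list \<Rightarrow> real" where
  "mixed_cost s t x y cs = (s * left_cost x cs + t * right_cost y cs) / 2"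

lemma mixed_cost_nonneg: "0 \<le> s \<Longrightarrow> 0 \<le> t \<Longrightarrow> 0 \<le> mixed_cost s t x y cs"
  by (simp add: mixed_cost_def left_cost_nonneg right_cost_nonneg)

lemma block_length_add_mixed_cost_le:
  assumes "0 \<le> s" "0 \<le> t" "1 \<le> s * t"
  shows "block_length c + mixed_cost (s * weight (left_bad x) c)
      (t * weight (\<lambda>c. right_bad c (foldr act cs y)) c) (inv (act c) x) y cs
    \<le> mixed_cost s t x y (c # cs)"
proof -
  have "1 \<le> (s + t) / 2"
    using arith_geo_mean_sqrt[of s t] assms real_sqrt_ge_one[of "s * t"] by linarith
  then have "1 * block_length c \<le> (s + t) / 2 * block_length c" by (rule mult_right_mono) simp
  then show ?thesis by (simp add: mixed_cost_def field_simps)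
qed

text \<open>
  A bad block replaces \<open>(s, t)\<close> by \<open>(s * a, t * b)\<close> with \<open>a * b \<ge> 1\<close>, so that \<open>s * t \<ge> 1\<close> persists
  until the first good block.
\<close>

lemma gromov_product_foldr_le:
  assumes "set cs \<subseteq> set_pmf \<beta>" "0 \<le> s" "0 \<le> t" "1 \<le> s * t"
  shows "gromov_product bp x (foldr act cs y) \<le> C + mixed_cost s t x y cs + dist bp y"
  using assms
proof (induction cs arbitrary: x s t)
  case Nil
  then show ?case using C_nonneg gromov_product_le[of bp x y] by (simp add: mixed_cost_def)
next
  case (Cons c cs)
  define v where "v = foldr act cs y"
  define a where "a = weight (left_bad x) c"
  define b where "b = weight (\<lambda>c. right_bad c v) c"
  let ?cost = "mixed_cost (s * a) (t * b) (inv (act c) x) y cs"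
  have weights_nonneg: "0 \<le> s * a" "0 \<le> t * b"
    using Cons.prems by (simp_all add: a_def b_def weight_bounds)
  have iso: "isometry (act c)" using Cons.prems(1) isometry_act by simp
  have "gromov_product bp x (act c v) \<le> C + (block_length c + ?cost) + dist bp y"
  proof (cases "c \<in> S \<and> \<not> left_bad x c \<and> \<not> right_bad c v")
    case True
    then have "2 * gromov_product bp x (act c v) \<le> C + block_length c"
      using good_block by (intro gromov_product_good_isometry_le[OF iso]) blast
    then show ?thesis
      using C_nonneg mixed_cost_nonneg[OF weights_nonneg, of "inv (act c) x" y cs]
        zero_le_dist[of bp "act c bp"] zero_le_dist[of bp y] by linarith
  next
    case False
    then have "1 \<le> a * b" unfolding a_def b_def by (intro one_le_weight_mult) auto
    then have "1 * 1 \<le> (s * t) * (a * b)" using Cons.prems(4) by (intro mult_mono) auto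
    then have "1 \<le> (s * a) * (t * b)" by (simp add: ac_simps)
    then have "gromov_product bp (inv (act c) x) v \<le> C + ?cost + dist bp y"
      unfolding v_def using Cons.prems(1) weights_nonneg by (intro Cons.IH) auto
    then show ?thesis using gromov_product_isometry_le[OF iso, of bp x v] by linarith
  qed
  also have "block_length c + ?cost \<le> mixed_cost s t x y (c # cs)"
    unfolding a_def b_def v_def using Cons.prems(2-4) by (rule block_length_add_mixed_cost_le)
  finally show ?case by (simp add: v_def)
qed

definition cost_bound :: real where "cost_bound = M / (1 - decay)"

lemma cost_bound_nonneg: "0 \<le> cost_bound"
  using decay_bounds M_nonneg by (simp add: cost_bound_def)

lemma cost_bound_fixpoint: "ennreal M + ennreal decay * ennreal cost_bound = ennreal cost_bound"
proof -
  have "M + decay * cost_bound = cost_bound" using decay_bounds by (simp add: cost_bound_def field_simps)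
  then show ?thesis
    using decay_bounds M_nonneg cost_bound_nonneg by (simp flip: ennreal_mult ennreal_plus)
qed

lemma nn_integral_cost_step_le:
  assumes "16 * card {c\<in>S. b c} \<le> card S"
  shows "(\<integral>\<^sup>+c. ennreal (block_length c) + ennreal (weight b c) * k \<partial>\<beta>) \<le> ennreal M + ennreal decay * k"
proof -
  have "(\<integral>\<^sup>+c. ennreal (block_length c) + ennreal (weight b c) * k \<partial>\<beta>)
      = first_moment bp (map_pmf act \<beta>) + (\<integral>\<^sup>+c. ennreal (weight b c) \<partial>\<beta>) * k"
    by (simp add: first_moment_def nn_integral_add nn_integral_multc)
  also have "\<dots> \<le> ennreal M + ennreal decay * k"
    by (intro add_mono mult_right_mono first_moment_act nn_integral_weight_le[OF assms]) simp
  finally show ?thesis .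
qed

lemma nn_integral_left_cost_le:
  "(\<integral>\<^sup>+cs. ennreal (left_cost x cs) \<partial>replicate_pmf n \<beta>) \<le> ennreal cost_bound"
proof (induction n arbitrary: x)
  case (Suc n)
  let ?E = "\<lambda>x. \<integral>\<^sup>+cs. ennreal (left_cost x cs) \<partial>replicate_pmf n \<beta>"
  have "(\<integral>\<^sup>+cs. ennreal (left_cost x cs) \<partial>replicate_pmf (Suc n) \<beta>)
      = (\<integral>\<^sup>+c. ennreal (block_length c) + ennreal (weight (left_bad x) c) * ?E (inv (act c) x) \<partial>\<beta>)"
    by (simp add: ennreal_plus ennreal_mult weight_bounds left_cost_nonneg nn_integral_add
        nn_integral_cmult measure_pmf.emeasure_space_1)
  also have "\<dots> \<le> (\<integral>\<^sup>+c. ennreal (block_length c) + ennreal (weight (left_bad x) c) * ennreal cost_bound \<partial>\<beta>)"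
    using Suc.IH by (intro nn_integral_mono add_mono mult_left_mono) auto
  also have "\<dots> \<le> ennreal M + ennreal decay * ennreal cost_bound"
    by (rule nn_integral_cost_step_le[OF card_left_bad])
  also have "\<dots> = ennreal cost_bound" by (rule cost_bound_fixpoint)
  finally show ?case .
qed simp

lemma nn_integral_right_cost_le:
  "(\<integral>\<^sup>+cs. ennreal (right_cost y cs) \<partial>replicate_pmf n \<beta>) \<le> ennreal cost_bound"
proof (induction n)
  case (Suc n)
  let ?b = "\<lambda>cs c. right_bad c (foldr act cs y)"
  have "replicate_pmf (Suc n) \<beta> = bind_pmf (replicate_pmf n \<beta>) (\<lambda>cs. bind_pmf \<beta> (\<lambda>c. return_pmf (c # cs)))"
    by (simp add: bind_commute_pmf[of \<beta>])
  then have "(\<integral>\<^sup>+cs. ennreal (right_cost y cs) \<partial>replicate_pmf (Suc n) \<beta>)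
      = (\<integral>\<^sup>+cs. (\<integral>\<^sup>+c. ennreal (block_length c) + ennreal (weight (?b cs) c) * ennreal (right_cost y cs)
          \<partial>\<beta>) \<partial>replicate_pmf n \<beta>)"
    by (simp add: ennreal_plus ennreal_mult weight_bounds right_cost_nonneg del: replicate_pmf.simps)
  also have "\<dots> \<le> (\<integral>\<^sup>+cs. ennreal M + ennreal decay * ennreal (right_cost y cs) \<partial>replicate_pmf n \<beta>)"
    by (intro nn_integral_mono nn_integral_cost_step_le card_right_bad)
  also have "\<dots> = ennreal M + ennreal decay * (\<integral>\<^sup>+cs. ennreal (right_cost y cs) \<partial>replicate_pmf n \<beta>)"
    by (simp add: nn_integral_add nn_integral_cmult measure_pmf.emeasure_space_1)
  also have "\<dots> \<le> ennreal M + ennreal decay * ennreal cost_bound"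
    using Suc.IH by (intro add_mono mult_left_mono) auto
  also have "\<dots> = ennreal cost_bound" by (rule cost_bound_fixpoint)
  finally show ?case .
qed simp

lemma nn_integral_gromov_product_foldr_le:
  "(\<integral>\<^sup>+cs. ennreal (gromov_product bp x (foldr act cs y)) \<partial>replicate_pmf n \<beta>)
     \<le> ennreal (C + 2 * cost_bound) + ennreal (dist bp y)"
proof -
  let ?c = "ennreal (C + dist bp y)"
  have "(\<integral>\<^sup>+cs. ennreal (gromov_product bp x (foldr act cs y)) \<partial>replicate_pmf n \<beta>)
      \<le> (\<integral>\<^sup>+cs. ennreal (left_cost x cs) + ennreal (right_cost y cs) + ?c \<partial>replicate_pmf n \<beta>)"
  proof (rule nn_integral_mono_AE, unfold AE_measure_pmf_iff, rule ballI)
    fix cs assume "cs \<in> set_pmf (replicate_pmf n \<beta>)"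
    then have "set cs \<subseteq> set_pmf \<beta>" by (auto simp: set_replicate_pmf)
    from gromov_product_foldr_le[OF this, of 1 1 x y]
    have "gromov_product bp x (foldr act cs y) \<le> left_cost x cs + right_cost y cs + (C + dist bp y)"
      using left_cost_nonneg[of x cs] right_cost_nonneg[of y cs] by (simp add: mixed_cost_def field_simps)
    then show "ennreal (gromov_product bp x (foldr act cs y))
        \<le> ennreal (left_cost x cs) + ennreal (right_cost y cs) + ?c"
      using C_nonneg left_cost_nonneg[of x cs] right_cost_nonneg[of y cs]
      by (simp add: ennreal_leI flip: ennreal_plus)
  qed
  also have "\<dots> = (\<integral>\<^sup>+cs. ennreal (left_cost x cs) \<partial>replicate_pmf n \<beta>)
      + (\<integral>\<^sup>+cs. ennreal (right_cost y cs) \<partial>replicate_pmf n \<beta>) + ?c"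
    by (simp add: nn_integral_pmf_add_const nn_integral_add)
  also have "\<dots> \<le> ennreal cost_bound + ennreal cost_bound + ?c"
    by (intro add_mono nn_integral_left_cost_le nn_integral_right_cost_le order_refl)
  also have "\<dots> = ennreal (C + 2 * cost_bound) + ennreal (dist bp y)"
    using C_nonneg cost_bound_nonneg by (simp flip: ennreal_plus)
  finally show ?thesis .
qed

end

section \<open>Walks driven by a non-elementary measure\<close>

abbreviation word_eval :: "('a \<Rightarrow> 'a) list \<Rightarrow> 'a \<Rightarrow> 'a" where "word_eval \<equiv> foldr id"

lemma foldr_concat: "foldr f (concat xss) = foldr (foldr f) xss"
  by (induction xss) simp_all

lemma semigroup_gen_word:
  assumes "g \<in> semigroup_gen A"
  shows "\<exists>l. l \<noteq> [] \<and> set l \<subseteq> A \<and> word_eval l = g"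
  using assms
proof induction
  case (base g)
  then show ?case by (intro exI[of _ "[g]"]) simp
next
  case (comp g h)
  then obtain l l' where l: "l \<noteq> []" "set l \<subseteq> A" "word_eval l = g"
    and l': "set l' \<subseteq> A" "word_eval l' = h" by blast
  have "word_eval (l @ l') = g \<circ> h" by (rule ext) (simp add: l l')
  with l l' show ?case by (metis Un_least append_is_Nil_conv set_append)
qed

lemma map_word_eval_replicate_pmf: "map_pmf word_eval (replicate_pmf n \<mu>) = conv_pow \<mu> n"
  by (simp add: map_foldr_replicate_pmf)

locale spelled_schottky_pair = schottky_family bp f e C R r
  for bp :: "'a::metric_space" and f :: "bool \<Rightarrow> 'a \<Rightarrow> 'a" and e :: "bool \<Rightarrow> int"
    and C R :: real and r :: int +
  fixes \<mu> :: "('a \<Rightarrow> 'a) pmf" and spell :: "bool \<Rightarrow> ('a \<Rightarrow> 'a) list" and N :: nat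
  assumes isometry_support: "\<forall>g\<in>set_pmf \<mu>. isometry g"
    and finite_moment: "first_moment bp \<mu> < \<infinity>"
    and length_spell: "length (spell c) = N"
    and set_spell: "set (spell c) \<subseteq> set_pmf \<mu>"
    and word_eval_spell: "word_eval (spell c) = letter c"
begin

definition block :: "bool list \<Rightarrow> bool list \<Rightarrow> ('a \<Rightarrow> 'a) list" where
  "block bs cs = concat (map spell (bs @ True # cs))"

definition blocks :: "('a \<Rightarrow> 'a) list set" where
  "blocks = (\<lambda>(bs, cs). block bs cs) ` ({bs. length bs = 4} \<times> {cs. length cs = 4})"

definition left_bad :: "'a \<Rightarrow> ('a \<Rightarrow> 'a) list \<Rightarrow> bool" where
  "left_bad x c \<longleftrightarrow> (\<exists>bs cs. length bs = 4 \<and> length cs = 4 \<and> c = block bs cs \<and>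
     \<not> facing 1 4 True (fold (shift 1) bs x))"

definition right_bad :: "('a \<Rightarrow> 'a) list \<Rightarrow> 'a \<Rightarrow> bool" where
  "right_bad c y \<longleftrightarrow> (\<exists>bs cs. length bs = 4 \<and> length cs = 4 \<and> c = block bs cs \<and>
     \<not> facing (-1) 4 True (foldr letter cs y))"

lemma word_eval_block:
  "word_eval (block bs cs) y = foldr letter bs (letter True (foldr letter cs y))"
proof -
  have spell: "word_eval \<circ> spell = letter" by (rule ext) (simp add: word_eval_spell)
  have "word_eval (concat (map spell ws)) = foldr letter ws" for ws
    by (rule ext) (simp add: foldr_concat foldr_map spell)
  then show ?thesis unfolding block_def by (simp del: map_append)
qed

lemma inj_spell: "inj spell"
  using inj_letter word_eval_spell unfolding inj_def by metis

lemma N_pos: "0 < N"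
proof (rule ccontr)
  assume "\<not> 0 < N"
  then have "spell True = spell False" using length_spell by auto
  then show False using inj_spell by (simp add: inj_eq)
qed

lemma block_eq_iff:
  assumes "length bs = 4" "length cs = 4" "length bs' = 4" "length cs' = 4"
  shows "block bs cs = block bs' cs' \<longleftrightarrow> bs = bs' \<and> cs = cs'"
proof
  assume eq: "block bs cs = block bs' cs'"
  have "map spell (bs @ True # cs) = map spell (bs' @ True # cs')"
    by (rule concat_injective[OF eq[unfolded block_def]])
      (use assms length_spell in \<open>auto simp: zip_map_map simp del: map_append list.map\<close>)
  then have "bs @ True # cs = bs' @ True # cs'" using inj_spell by (simp only: inj_map_eq_map)
  then show "bs = bs' \<and> cs = cs'" using assms by simp
qed simp

lemma finite_words: "finite {bs :: bool list. length bs = n}"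
  using finite_lists_length_eq[of "UNIV :: bool set" n] by simp

lemma card_words: "card {bs :: bool list. length bs = 4} = 16"
  using card_lists_length_eq[of "UNIV :: bool set" 4] by simp

lemma finite_blocks: "finite blocks"
  by (simp add: blocks_def finite_words)

lemma card_blocks: "card blocks = 256"
proof -
  have "inj_on (\<lambda>(bs, cs). block bs cs) ({bs. length bs = 4} \<times> {cs. length cs = 4})"
    by (auto simp: inj_on_def block_eq_iff)
  then show ?thesis
    unfolding blocks_def by (simp add: card_image card_cartesian_product card_words)
qed

lemma blocks_subset: "blocks \<subseteq> set_pmf (replicate_pmf (9 * N) \<mu>)"
proof
  fix c assume "c \<in> blocks"
  then obtain bs cs where words: "length bs = 4" "length cs = 4" "c = block bs cs"
    by (auto simp: blocks_def)
  have "length (concat (map spell ws)) = length ws * N" for ws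
    by (induction ws) (simp_all add: length_spell)
  then have "length c = 9 * N" unfolding words(3) block_def using words(1,2) by (simp del: map_append)
  moreover have "set c \<subseteq> set_pmf \<mu>" using words(3) set_spell by (auto simp: block_def)
  ultimately show "c \<in> set_pmf (replicate_pmf (9 * N) \<mu>)" by (auto simp: set_replicate_pmf)
qed

lemma card_left_bad: "16 * card {c \<in> blocks. left_bad x c} \<le> card blocks"
proof -
  obtain w where "\<And>bs. length bs = 4 \<Longrightarrow> bs \<noteq> w \<Longrightarrow> facing 1 4 True (fold (shift 1) bs x)"
    using ex_exceptional_past_word[of 4 x] by blast
  then have "{c \<in> blocks. left_bad x c} \<subseteq> block w ` {cs. length cs = 4}"
    by (auto simp: left_bad_def)
  then have "card {c \<in> blocks. left_bad x c} \<le> card {cs :: bool list. length cs = 4}"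
    by (rule surj_card_le[OF finite_words])
  then show ?thesis by (simp add: card_blocks card_words)
qed

lemma card_right_bad: "16 * card {c \<in> blocks. right_bad c y} \<le> card blocks"
proof -
  obtain w where "\<And>cs. length cs = 4 \<Longrightarrow> cs \<noteq> w \<Longrightarrow> facing (-1) 4 True (foldr letter cs y)"
    using ex_exceptional_future_word[of 4 y] by blast
  then have "{c \<in> blocks. right_bad c y} \<subseteq> (\<lambda>bs. block bs w) ` {bs. length bs = 4}"
    by (auto simp: right_bad_def)
  then have "card {c \<in> blocks. right_bad c y} \<le> card {bs :: bool list. length bs = 4}"
    by (rule surj_card_le[OF finite_words])
  then show ?thesis by (simp add: card_blocks card_words)
qed

lemma dist_good_block:
  assumes "c \<in> blocks" "\<not> left_bad x c" "\<not> right_bad c y"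
  shows "dist x bp + dist bp y \<le> dist x (word_eval c y) + additivity_defect 4 True"
proof -
  obtain bs cs where words: "length bs = 4" "length cs = 4" "c = block bs cs"
    using assms(1) by (auto simp: blocks_def)
  then have "facing 1 4 True (fold (shift 1) bs x)" "facing (-1) 4 True (foldr letter cs y)"
    using assms unfolding left_bad_def right_bad_def by blast+
  then show ?thesis unfolding words(3) word_eval_block by (rule dist_word_ge[OF words(1,2)])
qed

sublocale block_walk bp "replicate_pmf (9 * N) \<mu>" word_eval blocks left_bad right_bad
  "additivity_defect 4 True" "enn2real (first_moment bp (conv_pow \<mu> (9 * N)))"
proof
  show "isometry (word_eval c)" if "c \<in> set_pmf (replicate_pmf (9 * N) \<mu>)" for c
    using that isometry_support by (intro isometry_foldr) (auto simp: set_replicate_pmf)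
  show "blocks \<noteq> {}" using card_blocks by auto
  show "first_moment bp (map_pmf word_eval (replicate_pmf (9 * N) \<mu>))
      \<le> ennreal (enn2real (first_moment bp (conv_pow \<mu> (9 * N))))"
    using first_moment_conv_pow_finite[OF isometry_support finite_moment]
    by (simp add: map_word_eval_replicate_pmf)
qed (fact finite_blocks blocks_subset card_left_bad card_right_bad dist_good_block
    additivity_defect_nonneg enn2real_nonneg)+

lemma mean_gromov_product_conv_pow_le:
  "mean_gromov_product bp x (conv_pow \<mu> n)
     \<le> ennreal (additivity_defect 4 True + 2 * cost_bound) + of_nat (9 * N) * first_moment bp \<mu>"
proof -
  define K where "K = 9 * N"
  define q where "q = n div K"
  define t where "t = n mod K"
  let ?E = "ennreal (additivity_defect 4 True + 2 * cost_bound)"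
  have "conv_pow \<mu> n = conv (conv_pow (map_pmf word_eval (replicate_pmf K \<mu>)) q) (conv_pow \<mu> t)"
    unfolding map_word_eval_replicate_pmf conv_pow_mult[symmetric] conv_pow_add[symmetric]
    by (simp add: q_def t_def)
  then have "mean_gromov_product bp x (conv_pow \<mu> n)
      = (\<integral>\<^sup>+cs. \<integral>\<^sup>+u. ennreal (gromov_product bp x (foldr word_eval cs (u bp)))
          \<partial>conv_pow \<mu> t \<partial>replicate_pmf q (replicate_pmf K \<mu>))"
    by (simp add: mean_gromov_product_def nn_integral_conv flip: map_foldr_replicate_pmf)
  also have "\<dots> = (\<integral>\<^sup>+u. \<integral>\<^sup>+cs. ennreal (gromov_product bp x (foldr word_eval cs (u bp)))
          \<partial>replicate_pmf q (replicate_pmf K \<mu>) \<partial>conv_pow \<mu> t)"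
    by (rule nn_integral_pmf_commute)
  also have "\<dots> \<le> (\<integral>\<^sup>+u. ennreal (dist bp (u bp)) + ?E \<partial>conv_pow \<mu> t)"
    unfolding K_def add.commute[of _ ?E] by (intro nn_integral_mono nn_integral_gromov_product_foldr_le)
  also have "\<dots> = first_moment bp (conv_pow \<mu> t) + ?E"
    by (simp add: nn_integral_pmf_add_const first_moment_def)
  also have "\<dots> \<le> of_nat t * first_moment bp \<mu> + ?E"
    by (intro add_right_mono first_moment_conv_pow_le isometry_support)
  also have "\<dots> \<le> of_nat K * first_moment bp \<mu> + ?E"
    using N_pos by (intro add_right_mono mult_right_mono of_nat_mono) (simp_all add: t_def K_def)
  finally show ?thesis by (simp add: K_def add.commute)
qed

end

lemma non_elementary_words:
  assumes "non_elementary bp \<mu>"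
  obtains word :: "bool \<Rightarrow> ('a::metric_space \<Rightarrow> 'a) list"
  where "\<And>c. word c \<noteq> []" "\<And>c. set (word c) \<subseteq> set_pmf \<mu>"
    "\<forall>c c'. c \<noteq> c' \<longrightarrow> independent bp (word_eval (word c)) (word_eval (word c'))"
proof -
  obtain g h where gh: "g \<in> semigroup_gen (set_pmf \<mu>)" "h \<in> semigroup_gen (set_pmf \<mu>)"
    and independent: "independent bp g h"
    using assms unfolding non_elementary_def by blast
  obtain lg lh where lg: "lg \<noteq> []" "set lg \<subseteq> set_pmf \<mu>" "word_eval lg = g"
    and lh: "lh \<noteq> []" "set lh \<subseteq> set_pmf \<mu>" "word_eval lh = h"
    using gh semigroup_gen_word by meson
  show ?thesis
  proof (rule that[of "\<lambda>c. if c then lg else lh"])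
    show "\<forall>c c'. c \<noteq> c' \<longrightarrow>
        independent bp (word_eval (if c then lg else lh)) (word_eval (if c' then lg else lh))"
      using independent lg lh by (auto simp: independent_def)
  qed (use lg lh in auto)
qed

lemma bounded_mean_gromov_product:
  fixes bp :: "'a::metric_space"
  assumes geodesic: "geodesic_space TYPE('a)" and iso: "\<forall>g\<in>set_pmf \<mu>. isometry g"
    and non_elementary: "non_elementary bp \<mu>" and moment: "first_moment bp \<mu> < \<infinity>"
  obtains D where "0 \<le> D" "\<And>x n. mean_gromov_product bp x (conv_pow \<mu> n) \<le> ennreal D"
proof -
  obtain word :: "bool \<Rightarrow> ('a \<Rightarrow> 'a) list"
    where word_nonempty: "\<And>c. word c \<noteq> []" and set_word: "\<And>c. set (word c) \<subseteq> set_pmf \<mu>"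
      and independent: "\<forall>c c'. c \<noteq> c' \<longrightarrow> independent bp (word_eval (word c)) (word_eval (word c'))"
    using non_elementary_words[OF non_elementary] by blast
  have isometry: "isometry (word_eval (word c))" for c
    using set_word[of c] iso by (intro isometry_foldr) auto
  have contracting: "contracting bp (word_eval (word c))" for c
    using independent[rule_format, of c "\<not> c"] by (simp add: independent_def)
  obtain C R r T where schottky:
    "\<forall>e. (\<forall>c. T \<le> e c) \<longrightarrow> schottky_family bp (\<lambda>c. word_eval (word c)) e C R r"
    using independent_schottky_family[OF geodesic, of "\<lambda>c. word_eval (word c)" bp,
        OF isometry contracting independent] by (elim exE)
  text \<open>Multiplying the exponent by the length of the other word equalizes the spelled lengths.\<close>
  define k where "k c = length (word (\<not> c)) * nat T" for c
  define N where "N = length (word True) * length (word False) * nat T"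
  have "T \<le> int (k c)" for c
  proof -
    have "nat T \<le> k c" using word_nonempty[of "\<not> c"] by (simp add: k_def Suc_le_eq)
    then show ?thesis by linarith
  qed
  then interpret schottky_family bp "\<lambda>c. word_eval (word c)" "\<lambda>c. int (k c)" C R r
    using schottky by simp
  interpret spelled_schottky_pair bp "\<lambda>c. word_eval (word c)" "\<lambda>c. int (k c)" C R r \<mu>
    "\<lambda>c. concat (replicate (k c) (word c))" N
  proof
    show "length (concat (replicate (k c) (word c))) = N" for c
      by (cases c) (simp_all add: length_concat sum_list_replicate k_def N_def)
    show "set (concat (replicate (k c) (word c))) \<subseteq> set_pmf \<mu>" for c
      using set_word[of c] by auto
    show "word_eval (concat (replicate (k c) (word c))) = letter c" for c
      by (simp add: foldr_concat letter_def zpow_of_nat)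
  qed (use iso moment in auto)
  let ?D = "ennreal (additivity_defect 4 True + 2 * cost_bound) + of_nat (9 * N) * first_moment bp \<mu>"
  have "?D < \<infinity>" using moment by (simp add: ennreal_mult_less_top of_nat_less_top)
  then show ?thesis
    using mean_gromov_product_conv_pow_le by (intro that[of "enn2real ?D"]) simp_all
qed

section \<open>Lipschitz continuity of the escape rate\<close>

lemma subadditive_mult_add_le:
  fixes a :: "nat \<Rightarrow> real"
  assumes subadditive: "\<And>m n. a (m + n) \<le> a m + a n"
  shows "a (m * q + r) \<le> real q * a m + a r"
proof (induction q)
  case (Suc q)
  have "a (m * Suc q + r) \<le> a m + a (m * q + r)"
    using subadditive[of m "m * q + r"] by (simp add: add.assoc)
  with Suc show ?case by (simp add: algebra_simps)
qed simp

lemma subadditive_LIMSEQ_Inf: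
  fixes a :: "nat \<Rightarrow> real"
  assumes subadditive: "\<And>m n. a (m + n) \<le> a m + a n"
    and bdd: "bdd_below ((\<lambda>n. a n / real n) ` {1..})"
  shows "(\<lambda>n. a n / real n) \<longlonglongrightarrow> (INF n\<in>{1..}. a n / real n)"
proof (rule order_tendstoI)
  fix y assume y: "y < (INF n\<in>{1..}. a n / real n)"
  have "y < a n / real n" if "1 \<le> n" for n
    using y cINF_lower[OF bdd, of n] that by simp
  then show "\<forall>\<^sub>F n in sequentially. y < a n / real n"
    unfolding eventually_sequentially by blast
next
  fix y assume "(INF n\<in>{1..}. a n / real n) < y"
  then obtain m where m: "1 \<le> m" "a m / real m < y"
    using cINF_less_iff[OF _ bdd, of y] by auto
  define slope where "slope = a m / real m"
  define B where "B = Max ((\<lambda>r. a r - real r * slope) ` {..<m})"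
  have upper: "a n / real n \<le> slope + B / real n" if "1 \<le> n" for n
  proof -
    have "a n \<le> real (n div m) * a m + a (n mod m)"
      using subadditive_mult_add_le[OF subadditive, of m "n div m" "n mod m"] by simp
    moreover have "a (n mod m) \<le> real (n mod m) * slope + B"
    proof -
      have "a (n mod m) - real (n mod m) * slope \<le> B" unfolding B_def using m by (intro Max_ge) auto
      then show ?thesis by linarith
    qed
    moreover have "real n = real m * real (n div m) + real (n mod m)"
      by (metis mult_div_mod_eq of_nat_add of_nat_mult)
    then have "real n * slope = real (n div m) * a m + real (n mod m) * slope"
      using m by (simp add: slope_def field_simps)
    ultimately have "a n \<le> real n * slope + B" by linarith
    with that show ?thesis by (simp add: field_simps)
  qed
  have "(\<lambda>n. slope + B / real n) \<longlonglongrightarrow> slope + 0"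
    by (intro tendsto_intros lim_const_over_n)
  then have "\<forall>\<^sub>F n in sequentially. slope + B / real n < y"
    using m by (intro order_tendstoD(2)) (simp_all add: slope_def)
  then show "\<forall>\<^sub>F n in sequentially. a n / real n < y"
    using eventually_ge_at_top[of 1] by eventually_elim (use upper in fastforce)
qed

lemma abs_summable_on_iff_summable_on_real:
  fixes f :: "'b \<Rightarrow> real"
  shows "Infinite_Set_Sum.abs_summable_on f A \<longleftrightarrow> f summable_on A"
  by (rule trans[OF abs_summable_equivalent[symmetric] summable_on_iff_abs_summable_on_real[symmetric]])

lemma integrable_measure_pmf_iff_summable_on:
  fixes \<phi> :: "'b \<Rightarrow> real"
  shows "integrable (measure_pmf p) \<phi> \<longleftrightarrow> (\<lambda>x. pmf p x * \<phi> x) summable_on UNIV"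
  unfolding abs_summable_on_iff_summable_on_real[symmetric]
  by (simp add: measure_pmf_eq_density integrable_density Infinite_Set_Sum.abs_summable_on_def)

lemma expectation_eq_infsum:
  fixes \<phi> :: "'b \<Rightarrow> real"
  shows "measure_pmf.expectation p \<phi> = (\<Sum>\<^sub>\<infinity>x. pmf p x * \<phi> x)"
proof (cases "integrable (measure_pmf p) \<phi>")
  case True
  then show ?thesis
    unfolding pmf_expectation_eq_infsetsum integrable_measure_pmf_iff_summable_on
    by (intro infsetsum_infsum) (simp only: abs_summable_on_iff_summable_on_real)
next
  case False
  then show ?thesis
    by (simp add: not_integrable_integral_eq integrable_measure_pmf_iff_summable_on infsum_not_exists)
qed

lemma L_mean_eq_expectation: "L_mean bp p = measure_pmf.expectation p (word_norm bp)"
  by (simp add: L_mean_def expectation_eq_infsum)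

lemma L_mean_eq_first_moment: "L_mean bp p = enn2real (first_moment bp p)"
  unfolding L_mean_eq_expectation first_moment_def
  by (subst integral_eq_nn_integral) (simp_all add: word_norm_def)

lemma ennreal_L_mean: "first_moment bp p < \<infinity> \<Longrightarrow> ennreal (L_mean bp p) = first_moment bp p"
  by (simp add: L_mean_eq_first_moment)

lemma L_mean_nonneg: "0 \<le> L_mean bp p"
  by (simp add: L_mean_eq_first_moment)

lemma integrable_word_norm_iff: "integrable (measure_pmf p) (word_norm bp) \<longleftrightarrow> first_moment bp p < \<infinity>"
  by (simp add: integrable_iff_bounded first_moment_def word_norm_def)

lemma finite_first_moment_iff: "finite_first_moment bp p \<longleftrightarrow> first_moment bp p < \<infinity>"
  unfolding finite_first_moment_def integrable_word_norm_iff[symmetric]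
    integrable_measure_pmf_iff_summable_on by (simp add: mult.commute)

lemma finite_first_moment_perturb:
  assumes "finite_first_moment bp p" "finite_norm01 bp (\<lambda>g. pmf q g - pmf p g)"
  shows "finite_first_moment bp q"
  unfolding finite_first_moment_def
proof (rule summable_on_comparison_test)
  show "(\<lambda>g. word_norm bp g * pmf p g + word_norm bp g * \<bar>pmf q g - pmf p g\<bar>) summable_on UNIV"
    using assms by (intro summable_on_add) (auto simp: finite_first_moment_def finite_norm01_def)
  show "word_norm bp g * pmf q g
      \<le> word_norm bp g * pmf p g + word_norm bp g * \<bar>pmf q g - pmf p g\<bar>" for g
    unfolding distrib_left[symmetric] by (rule mult_left_mono) (auto simp: word_norm_def)
qed (simp add: word_norm_def)

lemma integrable_word_norm_bound:
  assumes "first_moment bp p < \<infinity>" "0 \<le> D" "\<forall>g\<in>set_pmf p. \<bar>\<phi> g\<bar> \<le> D + word_norm bp g"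
  shows "integrable p \<phi>"
proof (rule Bochner_Integration.integrable_bound)
  show "integrable p (\<lambda>g. D + word_norm bp g)"
    using assms(1) unfolding integrable_word_norm_iff[symmetric] by simp
  show "AE g in p. norm (\<phi> g) \<le> norm (D + word_norm bp g)"
    using assms(2,3) by (auto simp: AE_measure_pmf_iff intro: order_trans[OF _ abs_ge_self])
qed simp

lemma abs_expectation_diff_le:
  fixes \<phi> :: "'b \<Rightarrow> real"
  assumes "integrable (measure_pmf p) \<phi>" "integrable (measure_pmf q) \<phi>"
  shows "(\<lambda>x. \<bar>(pmf p x - pmf q x) * \<phi> x\<bar>) summable_on UNIV"
    and "\<bar>measure_pmf.expectation p \<phi> - measure_pmf.expectation q \<phi>\<bar>
      \<le> (\<Sum>\<^sub>\<infinity>x. \<bar>(pmf p x - pmf q x) * \<phi> x\<bar>)"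
proof -
  let ?s = "\<lambda>p x. pmf p x * \<phi> x" and ?d = "\<lambda>x. (pmf p x - pmf q x) * \<phi> x"
  have summable: "?s p summable_on UNIV" "(\<lambda>x. - ?s q x) summable_on UNIV"
    using assms unfolding integrable_measure_pmf_iff_summable_on summable_on_uminus by simp_all
  have diff: "?d = (\<lambda>x. ?s p x + - ?s q x)" by (simp add: left_diff_distrib)
  have "?d summable_on UNIV" unfolding diff using summable by (rule summable_on_add)
  then have "Infinite_Sum.abs_summable_on ?d UNIV"
    by (rule summable_on_iff_abs_summable_on_real[THEN iffD1])
  then show "(\<lambda>x. \<bar>?d x\<bar>) summable_on UNIV" by simp
  have "measure_pmf.expectation p \<phi> - measure_pmf.expectation q \<phi> = infsum ?d UNIV"
    unfolding diff infsum_add[OF summable] infsum_uminus expectation_eq_infsum by simp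
  also have "\<bar>\<dots>\<bar> \<le> (\<Sum>\<^sub>\<infinity>x. \<bar>?d x\<bar>)"
    using norm_infsum_bound[OF \<open>Infinite_Sum.abs_summable_on ?d UNIV\<close>] by simp
  finally show "\<bar>measure_pmf.expectation p \<phi> - measure_pmf.expectation q \<phi>\<bar> \<le> (\<Sum>\<^sub>\<infinity>x. \<bar>?d x\<bar>)" .
qed

lemma abs_expectation_diff_le_norm01:
  assumes finite_norm: "finite_norm01 bp (\<lambda>g. pmf p g - pmf q g)" (is "finite_norm01 bp ?\<eta>")
    and integrable: "integrable p \<phi>" "integrable (measure_pmf q) \<phi>" and D_nonneg: "0 \<le> D"
    and phi_bound: "\<forall>g\<in>set_pmf p \<union> set_pmf q. \<bar>\<phi> g\<bar> \<le> D + word_norm bp g"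
  shows "\<bar>measure_pmf.expectation p \<phi> - measure_pmf.expectation q \<phi>\<bar>
    \<le> max 1 D * norm01 bp (\<lambda>g. pmf p g - pmf q g)"
proof -
  have bound: "\<bar>?\<eta> g * \<phi> g\<bar> \<le> max 1 D * (\<bar>?\<eta> g\<bar> + word_norm bp g * \<bar>?\<eta> g\<bar>)" for g
  proof (cases "g \<in> set_pmf p \<union> set_pmf q")
    case True
    then have "\<bar>\<phi> g\<bar> \<le> D * 1 + 1 * word_norm bp g" using phi_bound by simp
    also have "\<dots> \<le> max 1 D * 1 + max 1 D * word_norm bp g"
      by (intro add_mono mult_right_mono) (simp_all add: word_norm_def)
    finally have "\<bar>?\<eta> g\<bar> * \<bar>\<phi> g\<bar> \<le> \<bar>?\<eta> g\<bar> * (max 1 D * (1 + word_norm bp g))"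
      by (intro mult_left_mono) (simp_all add: distrib_left)
    then show ?thesis unfolding abs_mult by (simp add: algebra_simps)
  next
    case False
    then show ?thesis by (simp add: set_pmf_iff)
  qed
  have summable: "(\<lambda>g. \<bar>?\<eta> g\<bar>) summable_on UNIV" "(\<lambda>g. word_norm bp g * \<bar>?\<eta> g\<bar>) summable_on UNIV"
    using finite_norm by (simp_all add: finite_norm01_def)
  have "\<bar>measure_pmf.expectation p \<phi> - measure_pmf.expectation q \<phi>\<bar> \<le> (\<Sum>\<^sub>\<infinity>g. \<bar>?\<eta> g * \<phi> g\<bar>)"
    by (rule abs_expectation_diff_le(2)[OF integrable])
  also have "\<dots> \<le> (\<Sum>\<^sub>\<infinity>g. max 1 D * (\<bar>?\<eta> g\<bar> + word_norm bp g * \<bar>?\<eta> g\<bar>))"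
    by (intro infsum_mono abs_expectation_diff_le(1)[OF integrable] bound
        summable_on_cmult_right summable_on_add summable)
  also have "\<dots> = max 1 D * norm01 bp ?\<eta>"
    by (simp add: infsum_cmult_right' infsum_add[OF summable] norm01_def norm0_def norm1_def)
  finally show ?thesis .
qed

definition sandwich :: "('a \<Rightarrow> 'a) pmf \<Rightarrow> ('a \<Rightarrow> 'a) pmf \<Rightarrow> ('a \<Rightarrow> 'a) \<Rightarrow> ('a \<Rightarrow> 'a) pmf" where
  "sandwich U V g = conv U (conv (return_pmf g) V)"

lemma first_moment_sandwich_le:
  assumes "\<forall>u\<in>set_pmf U. isometry u" "isometry g"
  shows "first_moment bp (sandwich U V g)
    \<le> first_moment bp U + (ennreal (word_norm bp g) + first_moment bp V)"
proof -
  have "first_moment bp (sandwich U V g) \<le> first_moment bp U + first_moment bp (conv (return_pmf g) V)"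
    unfolding sandwich_def by (rule first_moment_conv_le[OF assms(1)])
  also have "\<dots> \<le> first_moment bp U + (first_moment bp (return_pmf g) + first_moment bp V)"
    using assms(2) by (intro add_left_mono first_moment_conv_le) simp
  also have "first_moment bp (return_pmf g) = ennreal (word_norm bp g)"
    by (simp add: first_moment_def word_norm_def)
  finally show ?thesis .
qed

lemma dist_add_le_gromov_product:
  assumes "isometry u" "isometry g"
  shows "dist bp (u bp) + dist bp y
    \<le> dist bp (u (g y)) + 2 * gromov_product bp (inv (u \<circ> g) bp) y + word_norm bp g"
proof -
  have "dist (inv (u \<circ> g) bp) y = dist bp (u (g y))" for y
    using isometry_dist_inv[OF isometry_comp[OF assms]] by simp
  moreover have "dist bp (u bp) \<le> dist bp (u (g bp)) + word_norm bp g"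
    using dist_triangle2[of bp "u bp" "u (g bp)"] isometry_dist[OF assms(1), of bp "g bp"]
    by (simp add: word_norm_def)
  ultimately show ?thesis
    by (simp add: gromov_product_def dist_commute[of bp "inv (u \<circ> g) bp"] field_simps)
qed

lemma first_moment_le_sandwich:
  assumes iso: "\<forall>u\<in>set_pmf U. isometry u" "isometry g"
    and gromov: "\<And>x. mean_gromov_product bp x V \<le> ennreal D"
  shows "first_moment bp U + first_moment bp V
    \<le> first_moment bp (sandwich U V g) + 2 * ennreal D + ennreal (word_norm bp g)"
proof -
  let ?x = "\<lambda>u. inv (u \<circ> g) bp" and ?w = "ennreal (word_norm bp g)"
  have "first_moment bp U + first_moment bp V
      = (\<integral>\<^sup>+u. \<integral>\<^sup>+v. ennreal (dist bp (u bp) + dist bp (v bp)) \<partial>V \<partial>U)"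
    by (simp add: first_moment_def ennreal_plus nn_integral_add nn_integral_pmf_add_const
        measure_pmf.emeasure_space_1)
  also have "\<dots> \<le> (\<integral>\<^sup>+u. \<integral>\<^sup>+v. ennreal (dist bp (u (g (v bp))))
      + 2 * ennreal (gromov_product bp (?x u) (v bp)) + ?w \<partial>V \<partial>U)"
  proof (rule nn_integral_mono_AE, unfold AE_measure_pmf_iff, intro ballI nn_integral_mono)
    fix u v assume "u \<in> set_pmf U"
    then have "isometry u" using iso by blast
    from ennreal_leI[OF dist_add_le_gromov_product[OF this iso(2), of bp "v bp"]]
    show "ennreal (dist bp (u bp) + dist bp (v bp))
        \<le> ennreal (dist bp (u (g (v bp)))) + 2 * ennreal (gromov_product bp (?x u) (v bp)) + ?w"
      by (simp add: ennreal_plus ennreal_mult gromov_product_nonneg word_norm_def)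
  qed
  also have "\<dots> = (\<integral>\<^sup>+u. (\<integral>\<^sup>+v. ennreal (dist bp (u (g (v bp)))) \<partial>V)
      + 2 * mean_gromov_product bp (?x u) V \<partial>U) + ?w"
    by (simp add: nn_integral_pmf_add_const nn_integral_add nn_integral_cmult mean_gromov_product_def)
  also have "\<dots> \<le> (\<integral>\<^sup>+u. (\<integral>\<^sup>+v. ennreal (dist bp (u (g (v bp)))) \<partial>V) + 2 * ennreal D \<partial>U) + ?w"
    by (intro add_right_mono nn_integral_mono add_left_mono mult_left_mono gromov) simp
  also have "\<dots> = first_moment bp (sandwich U V g) + 2 * ennreal D + ?w"
    by (simp add: nn_integral_pmf_add_const sandwich_def first_moment_def conv_def)
  finally show ?thesis .
qed

lemma first_moment_sandwich_finite:
  assumes "\<forall>u\<in>set_pmf U. isometry u" "isometry g"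
    and "first_moment bp U < \<infinity>" "first_moment bp V < \<infinity>"
  shows "first_moment bp (sandwich U V g) < \<infinity>"
  using assms(3,4) by (intro le_less_trans[OF first_moment_sandwich_le[OF assms(1,2)]]) simp

lemma L_mean_sandwich_bound:
  assumes iso: "\<forall>u\<in>set_pmf U. isometry u" "isometry g"
    and moments: "first_moment bp U < \<infinity>" "first_moment bp V < \<infinity>"
    and D_nonneg: "0 \<le> D" and gromov: "\<And>x. mean_gromov_product bp x V \<le> ennreal D"
  shows "\<bar>L_mean bp (sandwich U V g) - (L_mean bp U + L_mean bp V)\<bar> \<le> 2 * D + word_norm bp g"
proof -
  note moment_eq = ennreal_L_mean[OF moments(1), symmetric] ennreal_L_mean[OF moments(2), symmetric]
    ennreal_L_mean[OF first_moment_sandwich_finite[OF iso moments], symmetric]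
  have "ennreal (L_mean bp (sandwich U V g)) \<le> ennreal (L_mean bp U + (word_norm bp g + L_mean bp V))"
    using first_moment_sandwich_le[OF iso, of bp V] unfolding moment_eq
    by (simp add: ennreal_plus L_mean_nonneg word_norm_def)
  moreover have "ennreal (L_mean bp U + L_mean bp V)
      \<le> ennreal (L_mean bp (sandwich U V g) + 2 * D + word_norm bp g)"
    using first_moment_le_sandwich[OF iso gromov] D_nonneg unfolding moment_eq
    by (simp add: ennreal_plus ennreal_mult L_mean_nonneg word_norm_def)
  ultimately show ?thesis
    using D_nonneg L_mean_nonneg[of bp] by (simp add: ennreal_le_iff word_norm_def del: ennreal_plus)
qed

lemma L_mean_conv_eq_expectation:
  assumes iso: "\<forall>u\<in>set_pmf U. isometry u" "\<forall>g\<in>set_pmf p. isometry g"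
    and moments: "first_moment bp U < \<infinity>" "first_moment bp V < \<infinity>"
  shows "L_mean bp (conv U (conv p V))
    = measure_pmf.expectation p (\<lambda>g. L_mean bp (sandwich U V g))"
proof -
  have "first_moment bp (conv U (conv p V))
      = (\<integral>\<^sup>+g. first_moment bp (sandwich U V g) \<partial>p)"
    by (simp add: first_moment_def sandwich_def conv_def nn_integral_pmf_commute[where p = U and q = p])
  also have "\<dots> = (\<integral>\<^sup>+g. ennreal (L_mean bp (sandwich U V g)) \<partial>p)"
    using iso(2) by (intro nn_integral_cong_AE)
      (simp add: AE_measure_pmf_iff ennreal_L_mean[OF first_moment_sandwich_finite[OF iso(1) _ moments]])
  finally show ?thesis
    unfolding L_mean_eq_first_moment[of bp "conv U _"]
    by (simp add: integral_eq_nn_integral L_mean_nonneg)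
qed

lemma L_mean_replace_le:
  assumes iso: "\<forall>u\<in>set_pmf U. isometry u" "\<forall>g\<in>set_pmf p \<union> set_pmf q. isometry g"
    and moments: "first_moment bp U < \<infinity>" "first_moment bp V < \<infinity>"
      "first_moment bp p < \<infinity>" "first_moment bp q < \<infinity>"
    and D_nonneg: "0 \<le> D" and gromov: "\<And>x. mean_gromov_product bp x V \<le> ennreal D"
    and finite_norm: "finite_norm01 bp (\<lambda>g. pmf p g - pmf q g)"
  shows "\<bar>L_mean bp (conv U (conv p V)) - L_mean bp (conv U (conv q V))\<bar>
    \<le> max 1 (2 * D) * norm01 bp (\<lambda>g. pmf p g - pmf q g)"
proof -
  let ?E = "measure_pmf.expectation"
  define A where "A = L_mean bp U + L_mean bp V"
  define \<phi> where "\<phi> g = L_mean bp (sandwich U V g) - A" for g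
  have phi_bound: "\<forall>g\<in>set_pmf p \<union> set_pmf q. \<bar>\<phi> g\<bar> \<le> 2 * D + word_norm bp g"
    unfolding \<phi>_def A_def using L_mean_sandwich_bound[OF iso(1) _ moments(1,2) D_nonneg gromov] iso(2) by blast
  then have integrable: "integrable p \<phi>" "integrable q \<phi>"
    using moments(3,4) D_nonneg by (auto intro!: integrable_word_norm_bound[of bp _ "2 * D"])
  have "L_mean bp (conv U (conv s V)) = ?E s \<phi> + A"
    if "\<forall>g\<in>set_pmf s. isometry g" "integrable s \<phi>" for s
  proof -
    have "L_mean bp (conv U (conv s V)) = ?E s (\<lambda>g. \<phi> g + A)"
      using L_mean_conv_eq_expectation[OF iso(1) that(1) moments(1,2)] by (simp add: \<phi>_def)
    also have "\<dots> = ?E s \<phi> + A" using that(2) by simp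
    finally show ?thesis .
  qed
  then show ?thesis
    using abs_expectation_diff_le_norm01[OF finite_norm integrable _ phi_bound] iso(2) integrable D_nonneg by simp
qed

lemma L_mean_conv_pow_diff_le:
  assumes iso: "\<forall>g\<in>set_pmf \<mu> \<union> set_pmf \<mu>'. isometry g"
    and moments: "first_moment bp \<mu> < \<infinity>" "first_moment bp \<mu>' < \<infinity>"
    and D_nonneg: "0 \<le> D" and gromov: "\<And>x n. mean_gromov_product bp x (conv_pow \<mu> n) \<le> ennreal D"
    and finite_norm: "finite_norm01 bp (\<lambda>g. pmf \<mu>' g - pmf \<mu> g)"
  shows "\<bar>L_mean bp (conv_pow \<mu>' n) - L_mean bp (conv_pow \<mu> n)\<bar>
    \<le> real n * (max 1 (2 * D) * norm01 bp (\<lambda>g. pmf \<mu>' g - pmf \<mu> g))"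
    (is "_ \<le> real n * ?\<delta>")
proof -
  define a where "a k = L_mean bp (conv (conv_pow \<mu>' k) (conv_pow \<mu> (n - k)))" for k
  have "norm (a (Suc k) - a k) \<le> ?\<delta>" if "k \<in> {..<n}" for k
  proof -
    define V where "V = conv_pow \<mu> (n - Suc k)"
    have "n - k = Suc (n - Suc k)" using that by auto
    then have "conv_pow \<mu> (n - k) = conv \<mu> V" by (simp add: V_def conv_pow_Suc_left)
    moreover have "conv (conv_pow \<mu>' (Suc k)) V = conv (conv_pow \<mu>' k) (conv \<mu>' V)"
      unfolding conv_pow_Suc by (rule conv_assoc)
    moreover have "\<bar>L_mean bp (conv (conv_pow \<mu>' k) (conv \<mu>' V))
        - L_mean bp (conv (conv_pow \<mu>' k) (conv \<mu> V))\<bar> \<le> ?\<delta>"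
      using iso moments D_nonneg gromov finite_norm unfolding V_def
      by (intro L_mean_replace_le isometry_conv_pow first_moment_conv_pow_finite) auto
    ultimately show ?thesis by (simp add: a_def V_def)
  qed
  then have "norm (\<Sum>k<n. a (Suc k) - a k) \<le> real (card {..<n}) * ?\<delta>" by (rule sum_norm_bound)
  then have "\<bar>a n - a 0\<bar> \<le> real n * ?\<delta>" by (simp only: sum_lessThan_telescope real_norm_def card_lessThan)
  then show ?thesis by (simp add: a_def conv_return_id)
qed

lemma escape_rate_LIMSEQ:
  assumes iso: "\<forall>g\<in>set_pmf \<mu>. isometry g" and moment: "first_moment bp \<mu> < \<infinity>"
  shows "(\<lambda>n. L_mean bp (conv_pow \<mu> n) / real n) \<longlonglongrightarrow> escape_rate bp \<mu>"
proof -
  have moment_eq: "first_moment bp (conv_pow \<mu> n) = ennreal (L_mean bp (conv_pow \<mu> n))" for n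
    using first_moment_conv_pow_finite[OF iso moment] by (simp add: ennreal_L_mean)
  have "L_mean bp (conv_pow \<mu> (m + n)) \<le> L_mean bp (conv_pow \<mu> m) + L_mean bp (conv_pow \<mu> n)" for m n
    using first_moment_conv_le[OF isometry_conv_pow[OF iso], of bp m "conv_pow \<mu> n"]
    unfolding conv_pow_add[symmetric] moment_eq by (simp add: L_mean_nonneg flip: ennreal_plus)
  moreover have "bdd_below ((\<lambda>n. L_mean bp (conv_pow \<mu> n) / real n) ` {1..})"
    by (rule bdd_belowI2[of _ 0]) (simp add: L_mean_nonneg)
  ultimately have "convergent (\<lambda>n. L_mean bp (conv_pow \<mu> n) / real n)"
    by (intro convergentI[OF subadditive_LIMSEQ_Inf])
  then show ?thesis unfolding escape_rate_def by (simp add: convergent_LIMSEQ_iff)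
qed

lemma escape_rate_diff_le:
  assumes iso: "\<forall>g\<in>set_pmf \<mu> \<union> set_pmf \<mu>'. isometry g"
    and moment: "finite_first_moment bp \<mu>"
    and D_nonneg: "0 \<le> D" and gromov: "\<And>x n. mean_gromov_product bp x (conv_pow \<mu> n) \<le> ennreal D"
    and finite_norm: "finite_norm01 bp (\<lambda>g. pmf \<mu>' g - pmf \<mu> g)"
  shows "\<bar>escape_rate bp \<mu>' - escape_rate bp \<mu>\<bar>
    \<le> max 1 (2 * D) * norm01 bp (\<lambda>g. pmf \<mu>' g - pmf \<mu> g)" (is "_ \<le> ?\<delta>")
proof (rule LIMSEQ_le_const2)
  have moments: "first_moment bp \<mu> < \<infinity>" "first_moment bp \<mu>' < \<infinity>"
    using moment finite_first_moment_perturb[OF moment finite_norm] by (simp_all add: finite_first_moment_iff)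
  show "(\<lambda>n. \<bar>L_mean bp (conv_pow \<mu>' n) / real n - L_mean bp (conv_pow \<mu> n) / real n\<bar>)
      \<longlonglongrightarrow> \<bar>escape_rate bp \<mu>' - escape_rate bp \<mu>\<bar>"
    using iso moments by (intro tendsto_rabs tendsto_diff escape_rate_LIMSEQ) auto
  have "\<bar>L_mean bp (conv_pow \<mu>' n) / real n - L_mean bp (conv_pow \<mu> n) / real n\<bar> \<le> ?\<delta>" if "1 \<le> n" for n
    using L_mean_conv_pow_diff_le[OF iso moments D_nonneg gromov finite_norm, of n] that
    by (simp add: abs_divide divide_le_eq mult.commute flip: diff_divide_distrib)
  then show "\<exists>N. \<forall>n\<ge>N. \<bar>L_mean bp (conv_pow \<mu>' n) / real n - L_mean bp (conv_pow \<mu> n) / real n\<bar> \<le> ?\<delta>"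
    by blast
qed

theorem theorem1p2:
  fixes bp :: "'a::metric_space" and G :: "('a \<Rightarrow> 'a) set" and \<mu> :: "('a \<Rightarrow> 'a) pmf"
  assumes "geodesic_space TYPE('a)"
    and "isometry_group G" and "countable G"
    and "\<exists>g\<in>G. \<exists>h\<in>G. independent bp g h"
    and "set_pmf \<mu> \<subseteq> G" and "non_elementary bp \<mu>" and "finite_first_moment bp \<mu>"
  shows "\<exists>C>0. \<exists>\<epsilon>>0. \<forall>\<mu>'::('a \<Rightarrow> 'a) pmf. set_pmf \<mu>' \<subseteq> G \<longrightarrow>
           finite_norm01 bp (\<lambda>g. pmf \<mu>' g - pmf \<mu> g) \<longrightarrow>
           norm01 bp (\<lambda>g. pmf \<mu>' g - pmf \<mu> g) < \<epsilon> \<longrightarrow>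
           \<bar>escape_rate bp \<mu>' - escape_rate bp \<mu>\<bar> \<le> C * norm01 bp (\<lambda>g. pmf \<mu>' g - pmf \<mu> g)"
proof -
  have isometries: "\<forall>g\<in>set_pmf \<nu>. isometry g" if "set_pmf \<nu> \<subseteq> G" for \<nu>
    using assms(2) that by (auto simp: isometry_group_def)
  obtain D where D: "0 \<le> D" "\<And>x n. mean_gromov_product bp x (conv_pow \<mu> n) \<le> ennreal D"
    using bounded_mean_gromov_product[OF assms(1) isometries[OF assms(5)] assms(6)] assms(7)
    unfolding finite_first_moment_iff by blast
  have "\<bar>escape_rate bp \<mu>' - escape_rate bp \<mu>\<bar>
      \<le> max 1 (2 * D) * norm01 bp (\<lambda>g. pmf \<mu>' g - pmf \<mu> g)"
    if "set_pmf \<mu>' \<subseteq> G" "finite_norm01 bp (\<lambda>g. pmf \<mu>' g - pmf \<mu> g)" for \<mu>'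
    using isometries[OF assms(5)] isometries[OF that(1)] assms(7) D that(2)
    by (intro escape_rate_diff_le) auto
  then show ?thesis
    by (intro exI[of _ "max 1 (2 * D)"] exI[of _ 1] conjI) (auto simp: zero_less_one)
qed

end
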